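(* Let $n\ge 3$ and $\mathbf c\in\mathbb R^n$ with $c_1<\dots<c_n$. The set of coherent monotone paths on the hypersimplex $\Delta(n,2)$ (with respect to $\mathbf c$) is in bijection with the set of coherent lattice paths of size $n$.
   Context: $\Delta(n,2)=\{\mathbf x\in[0,1]^n:\sum_ix_i=2\}$; vertices are $0/1$ vectors with two ones, $\operatorname{supp}(\mathbf v)=\{i:v_i=1\}$, vertices adjacent iff their supports share one element. A monotone path is $(\mathbf v_1,\dots,\mathbf v_r)$ from $\mathbf v_1=\mathbf e_1+\mathbf e_2$ to $\mathbf v_r=\mathbf e_{n-1}+\mathbf e_n$ along edges with $\langle\mathbf v_i,\mathbf c\rangle<\langle\mathbf v_{i+1},\mathbf c\rangle$. For $\boldsymbol\omega\in\mathbb R^n$ let $\pi^{\boldsymbol\omega}(\mathbf x)=(\langle\mathbf x,\mathbf c\rangle,\langle\mathbf x,\boldsymbol\omega\rangle)$; a proper face of the polygon $\pi^{\boldsymbol\omega}(\Delta(n,2))$ is upper if it has an outer normal with positive second coordinate. A monotone path is coherent if there is $\boldsymbol\omega$ such that the preimages in $\Delta(n,2)$ of the upper edges of $\pi^{\boldsymbol\omega}(\Delta(n,2))$ are exactly the edges $\mathbf v_i\mathbf v_{i+1}$ of the path (equivalently, it corresponds to a vertex of the monotone path polytope). A diagonal-avoiding lattice path of size $n$ (dimension 2) is a sequence of points $\boldsymbol\ell_1,\dots,\boldsymbol\ell_r\in[n]^2$ with $\boldsymbol\ell_1=(2,1)$, $\boldsymbol\ell_r\in\{(n-1,n),(n,n-1)\}$,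 the two coordinates of each point distinct, and consecutive points differing in exactly one coordinate, which strictly increases. The $i$-th enhanced step is $(a\to b;z)$ where the changing coordinate goes from $a$ to $b$ and the fixed coordinate is $z$; $\prec$ is the order of steps along the path. It is a coherent lattice path if for all enhanced steps $(i\to j;a)\prec(x\to y;z)$ with $x<j$ one has $j=z$ or $x=a$. *)

theory Defs
  imports "HOL-Analysis.Analysis"
begin

(* A vector of R^n is a function x :: nat => real, with coordinates x 1, ..., x n.  Points of the
   hypersimplex vanish outside {1..n}, so that each point has one representative.  The vectors c
   and omega occur only in inner products, where their values outside {1..n} do not matter. *)

definition dotp :: "nat \<Rightarrow> (nat \<Rightarrow> real) \<Rightarrow> (nat \<Rightarrow> real) \<Rightarrow> real" where
  "dotp n x y = (\<Sum>i\<in>{1..n}. x i * y i)"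

definition unit_vec :: "nat \<Rightarrow> nat \<Rightarrow> real" where
  "unit_vec i = (\<lambda>j. if j = i then 1 else 0)"

definition hypersimplex2 :: "nat \<Rightarrow> (nat \<Rightarrow> real) set" where
  "hypersimplex2 n =
     {x. (\<forall>i\<in>{1..n}. 0 \<le> x i \<and> x i \<le> 1) \<and> (\<forall>i. i \<notin> {1..n} \<longrightarrow> x i = 0) \<and> (\<Sum>i\<in>{1..n}. x i) = 2}"

definition hs_supp :: "nat \<Rightarrow> (nat \<Rightarrow> real) \<Rightarrow> nat set" where
  "hs_supp n v = {i \<in> {1..n}. v i = 1}"

definition hs_vertex :: "nat \<Rightarrow> (nat \<Rightarrow> real) \<Rightarrow> bool" where
  "hs_vertex n v \<longleftrightarrow>
     (\<forall>i\<in>{1..n}. v i = 0 \<or> v i = 1) \<and> (\<forall>i. i \<notin> {1..n} \<longrightarrow> v i = 0) \<and> card (hs_supp n v) = 2"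

definition hs_adjacent :: "nat \<Rightarrow> (nat \<Rightarrow> real) \<Rightarrow> (nat \<Rightarrow> real) \<Rightarrow> bool" where
  "hs_adjacent n u v \<longleftrightarrow>
     hs_vertex n u \<and> hs_vertex n v \<and> card (hs_supp n u \<inter> hs_supp n v) = 1"

(* closed_segment is not available here: nat => real is no instance of real_vector. *)
definition vec_segment :: "(nat \<Rightarrow> real) \<Rightarrow> (nat \<Rightarrow> real) \<Rightarrow> (nat \<Rightarrow> real) set" where
  "vec_segment u v = {(\<lambda>i. (1 - t) * u i + t * v i) | t. 0 \<le> t \<and> t \<le> 1}"

definition monotone_path :: "nat \<Rightarrow> (nat \<Rightarrow> real) \<Rightarrow> (nat \<Rightarrow> real) list \<Rightarrow> bool" where
  "monotone_path n c vs \<longleftrightarrow>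
     vs \<noteq> [] \<and>
     hd vs = (\<lambda>j. unit_vec 1 j + unit_vec 2 j) \<and>
     last vs = (\<lambda>j. unit_vec (n - 1) j + unit_vec n j) \<and>
     (\<forall>v\<in>set vs. hs_vertex n v) \<and>
     (\<forall>i. Suc i < length vs \<longrightarrow>
        hs_adjacent n (vs ! i) (vs ! Suc i) \<and> dotp n (vs ! i) c < dotp n (vs ! Suc i) c)"

definition proj :: "nat \<Rightarrow> (nat \<Rightarrow> real) \<Rightarrow> (nat \<Rightarrow> real) \<Rightarrow> (nat \<Rightarrow> real) \<Rightarrow> real \<times> real" where
  "proj n c \<omega> x = (dotp n x c, dotp n x \<omega>)"

definition upper_face :: "(real \<times> real) set \<Rightarrow> (real \<times> real) set \<Rightarrow> bool" where
  "upper_face P F \<longleftrightarrow>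
     F face_of P \<and> F \<noteq> {} \<and> F \<noteq> P \<and>
     (\<exists>u b. snd u > 0 \<and> P \<subseteq> {x. u \<bullet> x \<le> b} \<and> F = P \<inter> {x. u \<bullet> x = b})"

definition upper_edge :: "(real \<times> real) set \<Rightarrow> (real \<times> real) set \<Rightarrow> bool" where
  "upper_edge P F \<longleftrightarrow> F edge_of P \<and> upper_face P F"

definition coherent_monotone_path :: "nat \<Rightarrow> (nat \<Rightarrow> real) \<Rightarrow> (nat \<Rightarrow> real) list \<Rightarrow> bool" where
  "coherent_monotone_path n c vs \<longleftrightarrow>
     monotone_path n c vs \<and>
     (\<exists>\<omega>. {hypersimplex2 n \<inter> proj n c \<omega> -` F | F. upper_edge (proj n c \<omega> ` hypersimplex2 n) F}
          = {vec_segment (vs ! i) (vs ! Suc i) | i. Suc i < length vs})"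

definition diagonal_avoiding_path :: "nat \<Rightarrow> (nat \<times> nat) list \<Rightarrow> bool" where
  "diagonal_avoiding_path n ls \<longleftrightarrow>
     ls \<noteq> [] \<and>
     hd ls = (2, 1) \<and>
     last ls \<in> {(n - 1, n), (n, n - 1)} \<and>
     (\<forall>p\<in>set ls. p \<in> {1..n} \<times> {1..n} \<and> fst p \<noteq> snd p) \<and>
     (\<forall>i. Suc i < length ls \<longrightarrow>
        (fst (ls ! i) < fst (ls ! Suc i) \<and> snd (ls ! i) = snd (ls ! Suc i)) \<or>
        (fst (ls ! i) = fst (ls ! Suc i) \<and> snd (ls ! i) < snd (ls ! Suc i)))"

(* enhanced_step ls s = (a, b, z) encodes the step a -> b; z from ls ! s to ls ! Suc s
   (positions counted from 0). *)
definition enhanced_step :: "(nat \<times> nat) list \<Rightarrow> nat \<Rightarrow> nat \<times> nat \<times> nat" where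
  "enhanced_step ls s =
     (if snd (ls ! s) = snd (ls ! Suc s)
      then (fst (ls ! s), fst (ls ! Suc s), snd (ls ! s))
      else (snd (ls ! s), snd (ls ! Suc s), fst (ls ! s)))"

definition coherent_lattice_path :: "nat \<Rightarrow> (nat \<times> nat) list \<Rightarrow> bool" where
  "coherent_lattice_path n ls \<longleftrightarrow>
     diagonal_avoiding_path n ls \<and>
     (\<forall>s t i j a x y z.
        s < t \<and> Suc t < length ls \<and>
        enhanced_step ls s = (i, j, a) \<and> enhanced_step ls t = (x, y, z) \<and> x < j
        \<longrightarrow> j = z \<or> x = a)"

end

theory Submission
  imports Defs
begin

text \<open>
Regard \<open>h\<^sub>i(s) = \<omega>\<^sub>i + s c\<^sub>i\<close> as \<open>n\<close> lines with slopes \<open>c\<^sub>i\<close>. The face of \<open>\<Delta>(n,2)\<close> that maximizes \<open>h(s)\<close> is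
determined by the two highest lines at time \<open>s\<close>, so the coherent monotone path of \<open>\<omega>\<close> records how the
set of the two highest lines evolves: an edge \<open>e\<^sub>i + e\<^sub>a, e\<^sub>j + e\<^sub>a\<close> is a time at which \<open>j\<close> overtakes \<open>i\<close> in
second place below \<open>a\<close>. Listing the pairs as lattice points, the changed entry in its own coordinate,
identifies monotone paths with diagonal-avoiding lattice paths.

Two lines cross only once, which makes the path of \<open>\<omega>\<close> a coherent lattice path: if \<open>j\<close> overtakes \<open>i\<close> below
\<open>a\<close> and later \<open>x < j\<close> is overtaken below \<open>z\<close>, then \<open>x \<noteq> a\<close> would put \<open>j\<close> above \<open>x\<close> from the first event on,
hence \<open>j = z\<close>. Conversely, the lines of a coherent lattice path can be drawn one step at a time: the next
event is placed after all previous ones, and an index that enters for the first time gets the line of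
the prescribed slope through the crossing point. Coherence ensures that there is a time at which the
displaced line is still in second place and at which the new line stays below all earlier events.
\<close>

section \<open>Arrangements of lines\<close>

definition height :: "(nat \<Rightarrow> real) \<Rightarrow> (nat \<Rightarrow> real) \<Rightarrow> real \<Rightarrow> nat \<Rightarrow> real" where
  "height c \<omega> s i = \<omega> i + s * c i"

lemma height_fun_upd:
  "height c (fun_upd \<omega> y v) s i = (if i = y then v + s * c i else height c \<omega> s i)"
  by (simp add: height_def)

lemma height_less_forward:
  assumes "height c \<omega> s i \<le> height c \<omega> s j" "c i < c j" "s < t"
  shows "height c \<omega> t i < height c \<omega> t j"
proof -
  have "(t - s) * c i < (t - s) * c j" using assms by simp
  then show ?thesis using assms(1) by (simp add: height_def algebra_simps)
qed

lemma height_crossing: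
  assumes "height c \<omega> s i < height c \<omega> s j" "c j < c i"
  obtains t where "s < t" "height c \<omega> t i = height c \<omega> t j"
proof
  let ?t = "(\<omega> j - \<omega> i) / (c i - c j)"
  show "s < ?t" using assms by (simp add: height_def field_simps)
  show "height c \<omega> ?t i = height c \<omega> ?t j" using assms(2)
    by (simp add: height_def field_simps)
qed

text \<open>At time \<open>s\<close> the line \<open>a\<close> is highest and \<open>i\<close>, \<open>j\<close> meet in second place; read forward in time this
is the enhanced step \<open>(i \<rightarrow> j; a)\<close>.\<close>

definition exchange_at :: "nat set \<Rightarrow> (nat \<Rightarrow> real) \<Rightarrow> (nat \<Rightarrow> real) \<Rightarrow> real \<Rightarrow> nat \<Rightarrow> nat \<Rightarrow> nat \<Rightarrow> bool" where
  "exchange_at E c \<omega> s i j a \<longleftrightarrow>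
     height c \<omega> s i = height c \<omega> s j \<and> height c \<omega> s j < height c \<omega> s a \<and>
     (\<forall>l\<in>E - {i, j, a}. height c \<omega> s l < height c \<omega> s j)"

lemma exchange_at_le:
  "exchange_at E c \<omega> s i j a \<Longrightarrow> l \<in> E \<Longrightarrow> l \<noteq> a \<Longrightarrow> height c \<omega> s l \<le> height c \<omega> s j"
  unfolding exchange_at_def by (cases "l = i \<or> l = j") (auto intro: less_imp_le)

lemma exchange_at_insert:
  assumes "exchange_at E c \<omega> s i j a" "v + s * c y < height c \<omega> s j" "y \<notin> E" "{i, j, a} \<subseteq> E"
  shows "exchange_at (insert y E) c (fun_upd \<omega> y v) s i j a"
  using assms unfolding exchange_at_def by (auto simp: height_fun_upd)

lemma exchange_at_enter:
  assumes "height c \<omega> t x < height c \<omega> t z" "v + t * c y = height c \<omega> t x"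
    "\<And>l. l \<in> E - {x, z} \<Longrightarrow> height c \<omega> t l < height c \<omega> t x" "y \<notin> E" "x \<in> E" "z \<in> E"
  shows "exchange_at (insert y E) c (fun_upd \<omega> y v) t x y z"
  using assms unfolding exchange_at_def by (auto simp: height_fun_upd)

lemma exchange_at_coherent:
  assumes "exchange_at E c \<omega> s i j a" "exchange_at E c \<omega> t x y z" "s < t"
    and "strict_mono_on E c" "j \<in> E" "x \<in> E" "x < j"
  shows "j = z \<or> x = a"
proof (rule ccontr)
  assume "\<not> ?thesis"
  then have "height c \<omega> s x \<le> height c \<omega> s j" "height c \<omega> t j \<le> height c \<omega> t x"
    using assms exchange_at_le[of E] by (auto simp: exchange_at_def)
  moreover have "c x < c j" using assms by (auto simp: strict_mono_on_def)
  ultimately show False using height_less_forward[of c \<omega> s x j t] assms by simp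
qed

section \<open>Realizing coherent step sequences\<close>

text \<open>Step \<open>m\<close> is \<open>(I m \<rightarrow> J m; A m)\<close>. Step \<open>0\<close> is virtual: an extra index \<open>0\<close> is replaced by \<open>2\<close>
while \<open>1\<close> stays, so that every index but \<open>1\<close> gets a step at which it enters, and the real steps are
\<open>1, \<dots>, r\<close>. The virtual step never violates coherence.\<close>

locale step_sequence =
  fixes n r :: nat and I J A :: "nat \<Rightarrow> nat"
  assumes I0: "I 0 = 0" and J0: "J 0 = 2" and A0: "A 0 = 1"
    and I_less_J: "m \<le> r \<Longrightarrow> I m < J m"
    and A_neq: "m \<le> r \<Longrightarrow> A m \<noteq> I m \<and> A m \<noteq> J m"
    and bounded: "m \<le> r \<Longrightarrow> J m \<le> n \<and> A m \<le> n"
    and next_step: "m < r \<Longrightarrow> (I (Suc m) = J m \<and> A (Suc m) = A m) \<or> (I (Suc m) = A m \<and> A (Suc m) = J m)"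
    and final: "{J r, A r} = {n - 1, n}"
begin

definition seen :: "nat \<Rightarrow> nat set" where
  "seen k = {0, 1} \<union> J ` {..k}"

lemma seen_Suc: "seen (Suc k) = insert (J (Suc k)) (seen k)"
  by (auto simp: seen_def atMost_Suc)

lemma seen_mono: "k \<le> k' \<Longrightarrow> seen k \<subseteq> seen k'"
  by (auto simp: seen_def)

lemma current_seen: "k \<le> r \<Longrightarrow> I k \<in> seen k \<and> J k \<in> seen k \<and> A k \<in> seen k"
proof (induction k)
  case 0 then show ?case by (simp add: seen_def I0 J0 A0)
next
  case (Suc k)
  then show ?case using next_step[of k] by (auto simp: seen_Suc)
qed

lemma seen_current: "m \<le> k \<Longrightarrow> k \<le> r \<Longrightarrow> {I m, J m, A m} \<subseteq> seen k"
  using current_seen[of m] seen_mono[of m k] by auto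

lemma seen_cases: "l \<in> seen k \<Longrightarrow> 1 < l \<Longrightarrow> \<exists>m\<le>k. l = J m"
  by (auto simp: seen_def)

lemma pos: "m \<le> r \<Longrightarrow> 1 \<le> J m \<and> 1 \<le> A m"
proof (induction m)
  case 0 then show ?case by (simp add: J0 A0)
next
  case (Suc m) then show ?case using next_step[of m] I_less_J[of "Suc m"] by auto
qed

lemma enters:
  assumes "p < q" "q \<le> r" "v \<notin> {J p, A p}" "v \<in> {I q, A q}"
  shows "\<exists>m>p. m < q \<and> J m = v"
proof -
  have "p < q \<Longrightarrow> q \<le> r \<Longrightarrow> v \<in> {I q, A q} \<Longrightarrow> \<exists>m>p. m < q \<and> J m = v" for q
  proof (induction q)
    case (Suc q)
    have v: "v \<in> {J q, A q}" using next_step[of q] Suc.prems by auto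
    then have "p < q" using Suc.prems assms(3) by (metis less_SucE)
    show ?case
    proof (cases "J q = v")
      case True then show ?thesis using \<open>p < q\<close> by auto
    next
      case False then show ?thesis using v Suc.IH[OF \<open>p < q\<close>] Suc.prems by auto
    qed
  qed simp
  then show ?thesis using assms by blast
qed

lemma leaves:
  assumes "p \<le> r" "v \<in> {J p, A p}" "v \<notin> {n - 1, n}"
  shows "\<exists>q>p. q \<le> r \<and> I q = v"
proof (rule ccontr)
  assume no: "\<not> ?thesis"
  have "p \<le> q \<Longrightarrow> q \<le> r \<Longrightarrow> v \<in> {J q, A q}" for q
  proof (induction q rule: dec_induct)
    case base then show ?case using assms by simp
  next
    case (step q)
    have "v \<in> {I (Suc q), A (Suc q)}" using step next_step[of q] by auto
    then show ?case using no step by force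
  qed
  from this[of r] show False using assms final by auto
qed

end

locale coherent_step_sequence = step_sequence +
  assumes coherent: "p < q \<Longrightarrow> q \<le> r \<Longrightarrow> I q < J p \<Longrightarrow> J p = A q \<or> I q = A p"
begin

text \<open>Otherwise \<open>v\<close> leaves later, and coherence with step \<open>m\<close> forces \<open>J m\<close> to be back by then; its first
return displaces \<open>A m\<close>, and an earlier return of \<open>A m\<close> needs \<open>J m\<close> even earlier.\<close>

lemma no_smaller_partner:
  assumes "m < p" "p \<le> r" "J m \<notin> {J p, A p}" "A m \<notin> {J p, A p}" "A m < J m" "J m < n"
    and v: "v \<in> {J p, A p}" "v < J m"
  shows False
proof -
  have "v \<notin> {n - 1, n}" using assms by auto
  then obtain q where q: "q > p" "q \<le> r" "I q = v" using leaves assms by blast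
  then have "J m = A q" using coherent[of m q] assms by auto
  then have "\<exists>p1. p1 > p \<and> p1 < q \<and> J p1 = J m" using enters[of p q "J m"] assms q by auto
  then obtain p1 where p1: "p1 > p" "p1 < q" "J p1 = J m"
    and least: "\<And>p'. p' > p \<Longrightarrow> p' < p1 \<Longrightarrow> J p' \<noteq> J m"
    using exists_least_iff[of "\<lambda>x. x > p \<and> x < q \<and> J x = J m"] by (metis less_trans)
  have "p1 \<le> r" using p1 q by simp
  have "I p1 = A m" using coherent[of m p1] I_less_J[of p1] A_neq[of p1] p1 assms \<open>p1 \<le> r\<close> by auto
  then obtain p2 where p2: "p2 > p" "p2 < p1" "J p2 = A m"
    using enters[of p p1 "A m"] p1 assms \<open>p1 \<le> r\<close> by auto
  have "p2 \<le> r" using p2 \<open>p1 \<le> r\<close> by simp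
  then have "J m = A p2" using coherent[of m p2] I_less_J[of p2] p2 assms by auto
  then obtain p3 where "p3 > p" "p3 < p2" "J p3 = J m"
    using enters[of p p2 "J m"] p2 assms \<open>p2 \<le> r\<close> by auto
  then show False using least[of p3] p2 by simp
qed

lemma swap_increasing:
  assumes k: "k < r" and I: "I (Suc k) = A k" and A: "A (Suc k) = J k"
  shows "A k < J k"
proof (rule ccontr)
  assume "\<not> ?thesis"
  then have less: "J k < A k" using A_neq[of k] k by auto
  have "A k \<in> seen k" "1 < A k" using current_seen[of k] pos[of k] k less by auto
  then have ex: "\<exists>m\<le>k. J m = A k" using seen_cases by metis
  define m where "m = (GREATEST m. m \<le> k \<and> J m = A k)"
  have m: "m \<le> k" "J m = A k"
    using GreatestI_ex_nat[of "\<lambda>m. m \<le> k \<and> J m = A k" k] ex by (auto simp: m_def)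
  have last: "J m' \<noteq> A k" if "m < m'" "m' \<le> k" for m'
    using Greatest_le_nat[of "\<lambda>m. m \<le> k \<and> J m = A k" m' k] that by (auto simp: m_def)
  have "m < k" using m A_neq[of k] k by (cases "m = k") auto
  have noleave: "I m' \<noteq> A k" if "m < m'" "m' \<le> k" for m'
  proof
    assume *: "I m' = A k"
    then have "m' < k" using that A_neq[of k] k by (cases "m' = k") auto
    moreover have "A k \<notin> {J m', A m'}" using * I_less_J[of m'] A_neq[of m'] that k by auto
    ultimately obtain q where "q > m'" "q < k" "J q = A k"
      using enters[of m' k "A k"] k by auto
    then show False using last[of q] that by simp
  qed
  have chain: "A m' = A k \<and> A m < J m'" if "m < m'" "m' \<le> k" for m'
    using that
  proof (induction m')
    case (Suc q)
    have q: "q < r" "I (Suc q) < J (Suc q)" "I (Suc q) \<noteq> A k"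
      using Suc.prems k noleave[of "Suc q"] I_less_J[of "Suc q"] by auto
    show ?case
    proof (cases "q = m")
      case True
      then show ?thesis using next_step[of q] q m by auto
    next
      case False
      then have "A q = A k \<and> A m < J q" using Suc by simp
      then show ?thesis using next_step[of q] q by auto
    qed
  qed simp
  have "J m \<notin> {J (Suc k), A (Suc k)}" using m I A I_less_J[of "Suc k"] A_neq[of k] k by auto
  moreover have "A m < J k" using chain \<open>m < k\<close> by simp
  moreover have "J k < J (Suc k)" using less I I_less_J[of "Suc k"] k by auto
  moreover have "J m < n" using m I I_less_J[of "Suc k"] bounded[of "Suc k"] k by auto
  ultimately show False
    using no_smaller_partner[of m "Suc k" "J k"] less m A k by auto
qed

lemma swap_reentry:
  assumes k: "k < r" and I: "I (Suc k) = A k" and A: "A (Suc k) = J k"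
    and m: "m \<le> k" "J m = I k" "A m = A k" and less: "A k < I k"
  shows "I k \<le> J (Suc k)"
proof (rule ccontr)
  assume *: "\<not> ?thesis"
  have "I k < J k" "A k < J (Suc k)" using I_less_J[of k] I_less_J[of "Suc k"] k I by auto
  then show False
    using no_smaller_partner[of m "Suc k" "J (Suc k)"] m A k * less A_neq[of k] bounded[of k] by auto
qed


definition realized :: "(nat \<Rightarrow> real) \<Rightarrow> (nat \<Rightarrow> real) \<Rightarrow> (nat \<Rightarrow> real) \<Rightarrow> nat \<Rightarrow> bool" where
  "realized c \<omega> s k \<longleftrightarrow>
     (\<forall>m\<le>k. exchange_at (seen k) c \<omega> (s m) (I m) (J m) (A m)) \<and> (\<forall>m<k. s m < s (Suc m))"

lemma realizedD:
  assumes "realized c \<omega> s k" "m \<le> k"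
  shows "height c \<omega> (s m) (I m) = height c \<omega> (s m) (J m)"
    and "height c \<omega> (s m) (J m) < height c \<omega> (s m) (A m)"
    and "l \<in> seen k \<Longrightarrow> l \<noteq> A m \<Longrightarrow> height c \<omega> (s m) l \<le> height c \<omega> (s m) (J m)"
  using assms exchange_at_le[of "seen k"] unfolding realized_def by (auto simp: exchange_at_def)

lemma realized_times:
  assumes "realized c \<omega> s k" "m < m'" "m' \<le> k"
  shows "s m < s m'"
  using assms(2,3)
proof (induction m' rule: less_Suc_induct)
qed (use assms(1) in \<open>auto simp: realized_def\<close>)

lemma realized_step:
  assumes "realized c \<omega> s k" "s k < t"
    "exchange_at (seen (Suc k)) c \<omega>' t (I (Suc k)) (J (Suc k)) (A (Suc k))"
    "\<And>m. m \<le> k \<Longrightarrow> exchange_at (seen (Suc k)) c \<omega>' (s m) (I m) (J m) (A m)"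
  shows "realized c \<omega>' (fun_upd s (Suc k) t) (Suc k)"
  using assms unfolding realized_def by (auto simp: le_Suc_eq less_Suc_eq)

lemma realized_extend_new:
  assumes "k < r" "realized c \<omega> s k" "s k < t" "J (Suc k) \<notin> seen k"
    and "height c \<omega> t (I (Suc k)) < height c \<omega> t (A (Suc k))"
    and "\<And>l. l \<in> seen k - {I (Suc k), A (Suc k)} \<Longrightarrow> height c \<omega> t l < height c \<omega> t (I (Suc k))"
    and "\<And>m. m \<le> k \<Longrightarrow>
      height c \<omega> t (I (Suc k)) - (t - s m) * c (J (Suc k)) < height c \<omega> (s m) (J m)"
  shows "\<exists>\<omega>' s'. realized c \<omega>' s' (Suc k)"
proof -
  define v where "v = height c \<omega> t (I (Suc k)) - t * c (J (Suc k))"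
  have "{I (Suc k), A (Suc k)} \<subseteq> seen k"
    using next_step[of k] current_seen[of k] assms(1) by auto
  then have "exchange_at (insert (J (Suc k)) (seen k)) c (fun_upd \<omega> (J (Suc k)) v) t
      (I (Suc k)) (J (Suc k)) (A (Suc k))"
    using assms by (intro exchange_at_enter) (auto simp: v_def)
  moreover have "exchange_at (insert (J (Suc k)) (seen k)) c (fun_upd \<omega> (J (Suc k)) v) (s m)
      (I m) (J m) (A m)" if "m \<le> k" for m
    using assms that seen_current[of m k]
    by (intro exchange_at_insert) (auto simp: v_def realized_def algebra_simps)
  ultimately show ?thesis
    using realized_step[OF assms(2,3)] unfolding seen_Suc by blast
qed

lemma realized_extend_old:
  assumes "k < r" "realized c \<omega> s k" "s k < t" "J (Suc k) \<in> seen k"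
    and "exchange_at (seen k) c \<omega> t (I (Suc k)) (J (Suc k)) (A (Suc k))"
  shows "\<exists>\<omega>' s'. realized c \<omega>' s' (Suc k)"
  using realized_step[OF assms(2,3), of \<omega>] assms(2,4,5)
  unfolding seen_Suc realized_def by (metis insert_absorb)

context
  fixes c :: "nat \<Rightarrow> real"
  assumes c: "strict_mono_on {0..n} c"
begin

lemma c_less: "i < j \<Longrightarrow> j \<le> n \<Longrightarrow> c i < c j"
  using c by (auto simp: strict_mono_on_def)

text \<open>Here no known line steeper than \<open>J k\<close> is in the way, so the next crossing may take place at any time
shortly after \<open>s k\<close>.\<close>

lemma realized_stay:
  assumes k: "k < r" and R: "realized c \<omega> s k" and I: "I (Suc k) = J k" and A: "A (Suc k) = A k"
  shows "\<exists>\<omega>' s'. realized c \<omega>' s' (Suc k)"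
proof -
  have cx: "c (I k) < c (J k)" using c_less I_less_J[of k] bounded[of k] k by simp
  have cy: "c (J k) < c (J (Suc k))"
    using c_less I_less_J[of "Suc k"] bounded[of "Suc k"] k I by simp
  have not_top: "J k \<noteq> A m" if "m \<le> k" for m
  proof
    assume *: "J k = A m"
    with A_neq[of k] k that have "m < k" by (cases "m = k") auto
    then have "s m < s k" using realized_times R by simp
    moreover have "height c \<omega> (s m) (I k) < height c \<omega> (s m) (J k)"
      using realizedD(2)[OF R that] realizedD(3)[OF R that, of "I k"] current_seen[of k]
        I_less_J[of k] k * by fastforce
    ultimately have "height c \<omega> (s k) (I k) < height c \<omega> (s k) (J k)"
      using height_less_forward[of c \<omega> "s m" "I k" "J k" "s k"] cx by simp
    then show False using realizedD(1)[OF R order_refl] by simp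
  qed
  have low: "c l < c (J k)" if l: "l \<in> seen k - {J k, A k}" for l
  proof (rule ccontr)
    assume "\<not> ?thesis"
    then have less: "J k < l"
      using l c_less[of l "J k"] bounded[of k] k by (metis DiffE insert_iff linorder_neqE_nat order_less_imp_le)
    moreover have "1 \<le> J k" using pos k by simp
    ultimately obtain m where m: "m \<le> k" "l = J m" using seen_cases[of l k] l by auto
    then show False
      using coherent[of m "Suc k"] less k l I A not_top[of m] by auto
  qed
  have "((\<lambda>t. height c \<omega> t (A k) - height c \<omega> t (J k)) \<longlongrightarrow>
      height c \<omega> (s k) (A k) - height c \<omega> (s k) (J k)) (at_right (s k))"
    unfolding height_def by (intro tendsto_intros)
  then have "eventually (\<lambda>t. 0 < height c \<omega> t (A k) - height c \<omega> t (J k)) (at_right (s k))"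
    by (rule order_tendstoD) (use realizedD(2)[OF R order_refl] in simp)
  then obtain t where t: "s k < t" "height c \<omega> t (J k) < height c \<omega> t (A k)"
    using eventually_happens[OF eventually_conj[OF _ eventually_at_right_less[of "s k"]]]
    by (metis (lifting) diff_gt_0_iff_gt trivial_limit_at_right_real)
  have below: "height c \<omega> t l < height c \<omega> t (J k)" if "l \<in> seen k - {J k, A k}" for l
    using height_less_forward[of c \<omega> "s k" l "J k" t] low[OF that] t(1)
      realizedD(3)[OF R order_refl, of l] that by auto
  have past: "height c \<omega> t (J k) - (t - s m) * c (J (Suc k)) < height c \<omega> (s m) (J m)"
    if m: "m \<le> k" for m
  proof -
    have "s m < t" using realized_times[OF R, of m k] t(1) m by (cases "m = k") auto
    then have "(t - s m) * c (J k) < (t - s m) * c (J (Suc k))" using cy by simp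
    then have "height c \<omega> t (J k) - (t - s m) * c (J (Suc k)) < height c \<omega> (s m) (J k)"
      by (simp add: height_def algebra_simps)
    then show ?thesis
      using realizedD(3)[OF R m, of "J k"] not_top[OF m] current_seen[of k] k by simp
  qed
  have "J (Suc k) \<notin> seen k"
  proof
    assume "J (Suc k) \<in> seen k"
    then have "c (J (Suc k)) < c (J k)"
      using low A_neq[of "Suc k"] cy A k by force
    then show False using cy by simp
  qed
  then show ?thesis
    using realized_extend_new[OF k R t(1)] t below past I A by simp
qed

text \<open>The known lines steeper than the displaced line \<open>A k\<close> threaten to overtake it. If there are any, \<open>I k\<close>
is the first of them to do so, at time \<open>\<sigma>\<close> say, and the next crossing takes place at \<open>\<sigma>\<close> (when \<open>I k\<close>
returns) or just before it (when a new line enters). If there are none, a late crossing leaves the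
new line below all past crossings.\<close>

lemma realized_swap:
  assumes k: "k < r" and R: "realized c \<omega> s k" and I: "I (Suc k) = A k" and A: "A (Suc k) = J k"
  shows "\<exists>\<omega>' s'. realized c \<omega>' s' (Suc k)"
proof -
  note top = realizedD(2)[OF R order_refl] and le = realizedD(3)[OF R order_refl]
    and eq = realizedD(1)[OF R order_refl]
  have aj: "c (A k) < c (J k)"
    using c_less swap_increasing[OF k I A] bounded[of k] k by simp
  have ij: "c (I k) < c (J k)" using c_less I_less_J[of k] bounded[of k] k by simp
  have ay: "A k < J (Suc k)" using I_less_J[of "Suc k"] I k by simp
  then have cy: "c (A k) < c (J (Suc k))" using c_less bounded[of "Suc k"] k by simp
  have yj: "J (Suc k) \<noteq> J k" using A_neq[of "Suc k"] A k by auto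
  have ia: "I k \<noteq> A k" using A_neq[of k] k by auto
  have sk: "s m \<le> s k" if "m \<le> k" for m
    using realized_times[OF R, of m k] that by (cases "m = k") auto
  have low: "c l \<le> c (A k)" if l: "l \<in> seen k - {A k, J k}" and "l \<le> A k" for l
    using c_less[of l "A k"] that bounded[of k] k by (cases "l = A k") auto
  have below_low: "height c \<omega> t l < height c \<omega> t (A k)"
    if l: "l \<in> seen k - {A k, J k}" "l \<le> A k" and t: "s k < t" for l t
  proof -
    have "(t - s k) * c l \<le> (t - s k) * c (A k)" using low[OF l] t by simp
    moreover have "height c \<omega> (s k) l < height c \<omega> (s k) (A k)" using top le[of l] l by simp
    ultimately show ?thesis by (simp add: height_def algebra_simps)
  qed
  have threat: "\<exists>m\<le>k. l = J m \<and> A m = A k \<and> l \<le> I k"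
    if l: "l \<in> seen k - {A k, J k}" and less: "A k < l" for l
  proof -
    have "1 \<le> A k" using pos k by simp
    then obtain m where m: "m \<le> k" "l = J m" using seen_cases[of l k] l less by auto
    have am: "A m = A k" using coherent[of m "Suc k"] less m l I A k by auto
    moreover have "m < k" using m l by (cases "m = k") auto
    then have "l \<le> I k" using coherent[of m k] m l ia am k by (cases "I k < l") auto
    ultimately show ?thesis using m by blast
  qed
  show ?thesis
  proof (cases "I k < A k")
    case True
    have no_threat: "l \<le> A k" if "l \<in> seen k - {A k, J k}" for l
      using threat[OF that] True by fastforce
    then have new: "J (Suc k) \<notin> seen k" using ay yj by force
    have "eventually (\<lambda>t. \<forall>m\<in>{..k}. height c \<omega> t (A k) - (t - s m) * c (J (Suc k))
        < height c \<omega> (s m) (J m)) at_top"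
    proof (intro eventually_ball_finite ballI)
      fix m
      have "LIM t at_top. (c (J (Suc k)) - c (A k)) * t :> at_top"
        using cy by (intro filterlim_tendsto_pos_mult_at_top[OF tendsto_const]) (auto intro: filterlim_ident)
      then have "eventually (\<lambda>t. \<omega> (A k) + s m * c (J (Suc k)) - height c \<omega> (s m) (J m)
          < (c (J (Suc k)) - c (A k)) * t) at_top"
        by (simp add: filterlim_at_top_dense)
      then show "eventually (\<lambda>t. height c \<omega> t (A k) - (t - s m) * c (J (Suc k))
          < height c \<omega> (s m) (J m)) at_top"
        by eventually_elim (simp add: height_def algebra_simps)
    qed simp
    moreover obtain T where T: "s k < T" "height c \<omega> T (A k) = height c \<omega> T (J k)"
      using height_crossing[of c \<omega> "s k" "J k" "A k"] top aj by metis
    ultimately obtain t where t: "T < t"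
      "\<forall>m\<in>{..k}. height c \<omega> t (A k) - (t - s m) * c (J (Suc k)) < height c \<omega> (s m) (J m)"
      using eventually_happens[OF eventually_conj[OF _ eventually_gt_at_top[of T]]]
      by (metis (lifting) trivial_limit_at_top_linorder)
    have "height c \<omega> t (A k) < height c \<omega> t (J k)"
      using height_less_forward[of c \<omega> T "A k" "J k" t] T t aj by simp
    then show ?thesis
      using realized_extend_new[OF k R, of t] new I A t T below_low no_threat by simp
  next
    case False
    then have ai: "A k < I k" using ia by simp
    then have cai: "c (A k) < c (I k)" using c_less I_less_J[of k] bounded[of k] k by simp
    have i: "I k \<in> seen k - {A k, J k}" using current_seen[of k] ia I_less_J[of k] k by auto
    obtain \<sigma> where \<sigma>: "s k < \<sigma>" "height c \<omega> \<sigma> (I k) = height c \<omega> \<sigma> (A k)"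
      using height_crossing[of c \<omega> "s k" "I k" "A k"] top eq cai by metis
    have above: "height c \<omega> \<sigma> (A k) < height c \<omega> \<sigma> (J k)"
      using height_less_forward[of c \<omega> "s k" "I k" "J k" \<sigma>] \<sigma> eq ij by simp
    have "height c \<omega> t (I k) \<le> height c \<omega> t (A k)" if "t \<le> \<sigma>" for t
    proof -
      have "(\<sigma> - t) * c (A k) \<le> (\<sigma> - t) * c (I k)" using that cai by (intro mult_left_mono) auto
      then show ?thesis using \<sigma> by (simp add: height_def algebra_simps)
    qed
    moreover have threat_below: "height c \<omega> t l < height c \<omega> t (I k)"
      if l: "l \<in> seen k - {A k, J k}" "A k < l" "l \<noteq> I k" and t: "s k < t" for l t
    proof -
      have "l < I k" using threat[OF l(1,2)] l(3) by auto
      then have "c l < c (I k)" using c_less I_less_J[of k] bounded[of k] k by simp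
      moreover have "height c \<omega> (s k) l \<le> height c \<omega> (s k) (I k)" using le[of l] l eq by simp
      ultimately show ?thesis using height_less_forward t by blast
    qed
    ultimately have below: "height c \<omega> t l < height c \<omega> t (A k)"
      if "l \<in> seen k - {A k, J k}" "l \<noteq> I k" "s k < t" "t \<le> \<sigma>" for l t
      using that below_low[of l t] by (cases "A k < l") force+
    have "I k \<le> J (Suc k)"
      using threat[OF i ai] swap_reentry[OF k I A] ai by auto
    then consider "J (Suc k) = I k" | "I k < J (Suc k)" by linarith
    then show ?thesis
    proof cases
      case 1
      have "exchange_at (seen k) c \<omega> \<sigma> (I (Suc k)) (J (Suc k)) (A (Suc k))"
        using above \<sigma> below unfolding exchange_at_def 1 I A by auto
      then show ?thesis using realized_extend_old[OF k R \<sigma>(1)] 1 i by simp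
    next
      case 2
      then have cyi: "c (I k) < c (J (Suc k))" using c_less bounded[of "Suc k"] k by simp
      have new: "J (Suc k) \<notin> seen k"
        using threat[of "J (Suc k)"] 2 ay yj by fastforce
      have at_\<sigma>: "height c \<omega> \<sigma> (A k) - (\<sigma> - s m) * c (J (Suc k)) < height c \<omega> (s m) (J m)"
        if m: "m \<le> k" for m
      proof -
        have lt: "0 < \<sigma> - s m" using sk[OF m] \<sigma>(1) by simp
        have "height c \<omega> (s m) (I k) < height c \<omega> (s m) (A k)"
          using mult_strict_left_mono[OF cai lt] \<sigma>(2) by (simp add: height_def algebra_simps)
        then have "I k \<noteq> A m"
          using realizedD(2)[OF R m] realizedD(3)[OF R m, of "A k"] current_seen[of k] k by force
        then have "height c \<omega> (s m) (I k) \<le> height c \<omega> (s m) (J m)"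
          using realizedD(3)[OF R m] i by simp
        then show ?thesis
          using mult_strict_left_mono[OF cyi lt] \<sigma>(2) by (simp add: height_def algebra_simps)
      qed
      have lim: "((\<lambda>t. height c \<omega> t (A k) - (t - s m) * c (J (Suc k))) \<longlongrightarrow>
          height c \<omega> \<sigma> (A k) - (\<sigma> - s m) * c (J (Suc k))) (at_left \<sigma>)" for m
        unfolding height_def by (intro tendsto_intros)
      have past: "eventually (\<lambda>t. \<forall>m\<in>{..k}. height c \<omega> t (A k) - (t - s m) * c (J (Suc k))
          < height c \<omega> (s m) (J m)) (at_left \<sigma>)"
        by (intro eventually_ball_finite ballI order_tendstoD(2)[OF lim] at_\<sigma>) auto
      have "((\<lambda>t. height c \<omega> t (J k) - height c \<omega> t (A k)) \<longlongrightarrow>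
          height c \<omega> \<sigma> (J k) - height c \<omega> \<sigma> (A k)) (at_left \<sigma>)"
        unfolding height_def by (intro tendsto_intros)
      then have "eventually (\<lambda>t. 0 < height c \<omega> t (J k) - height c \<omega> t (A k)) (at_left \<sigma>)"
        by (rule order_tendstoD) (use above in simp)
      with past have "eventually (\<lambda>t. s k < t \<and> t < \<sigma> \<and>
          height c \<omega> t (A k) < height c \<omega> t (J k) \<and> (\<forall>m\<in>{..k}.
          height c \<omega> t (A k) - (t - s m) * c (J (Suc k)) < height c \<omega> (s m) (J m))) (at_left \<sigma>)"
        using eventually_at_left_real[OF \<sigma>(1)] by eventually_elim auto
      then obtain t where t: "s k < t" "t < \<sigma>" "height c \<omega> t (A k) < height c \<omega> t (J k)"
        "\<forall>m\<in>{..k}. height c \<omega> t (A k) - (t - s m) * c (J (Suc k)) < height c \<omega> (s m) (J m)"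
        using eventually_happens[of _ "at_left \<sigma>"] by (metis (lifting) trivial_limit_at_left_real)
      have "height c \<omega> t (I k) < height c \<omega> t (A k)"
        using mult_strict_left_mono[OF cai, of "\<sigma> - t"] t(2) \<sigma>(2)
        by (simp add: height_def algebra_simps)
      then have "height c \<omega> t l < height c \<omega> t (A k)" if "l \<in> seen k - {A k, J k}" for l
        using below[OF that, of t] t(1,2) by (cases "l = I k") auto
      then show ?thesis
        using realized_extend_new[OF k R t(1) new] t(3,4) I A by simp
    qed
  qed
qed

lemma realized_exists: "k \<le> r \<Longrightarrow> \<exists>\<omega> s. realized c \<omega> s k"
proof (induction k)
  case 0
  have "exchange_at (seen 0) c (\<lambda>l. if l = 1 then 1 else 0) 0 (I 0) (J 0) (A 0)"
    by (auto simp: exchange_at_def height_def I0 J0 A0 seen_def)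
  then have "realized c (\<lambda>l. if l = 1 then 1 else 0) (\<lambda>_. 0) 0"
    by (simp add: realized_def)
  then show ?case by blast
next
  case (Suc k)
  then show ?case using realized_stay realized_swap next_step[of k] by (metis Suc_le_lessD less_imp_le)
qed

lemma realization:
  "\<exists>\<omega> s. (\<forall>m\<le>r. exchange_at {0..n} c \<omega> (s m) (I m) (J m) (A m)) \<and> (\<forall>m<r. s m < s (Suc m))"
proof -
  obtain \<omega> s where R: "realized c \<omega> s r" using realized_exists by blast
  define f where "f l m = height c \<omega> (s m) (J m) - s m * c l" for l m
  define v where "v l = Min (f l ` {..r}) - 1" for l
  have v: "v l + s m * c l < height c \<omega> (s m) (J m)" if "m \<le> r" for l m
  proof -
    have "Min (f l ` {..r}) \<le> f l m" using that by simp
    then show ?thesis by (simp add: v_def f_def)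
  qed
  define \<omega>' where "\<omega>' l = (if l \<in> seen r then \<omega> l else v l)" for l
  have h: "height c \<omega>' t l = (if l \<in> seen r then height c \<omega> t l else v l + t * c l)" for t l
    by (simp add: \<omega>'_def height_def)
  have "exchange_at {0..n} c \<omega>' (s m) (I m) (J m) (A m)" if "m \<le> r" for m
    using R that v[OF that] seen_current[of m r] unfolding realized_def exchange_at_def
    by (auto simp: h)
  then show ?thesis using R unfolding realized_def by blast
qed

end

end

section \<open>Upper edges of projected hypersimplices\<close>

definition pair_vec :: "nat \<Rightarrow> nat \<Rightarrow> nat \<Rightarrow> real" where
  "pair_vec a b = (\<lambda>j. unit_vec a j + unit_vec b j)"

lemma pair_vec_commute: "pair_vec a b = pair_vec b a"
  by (simp add: pair_vec_def add.commute)

lemma pair_vec_supp: "a \<noteq> b \<Longrightarrow> {j. pair_vec a b j = 1} = {a, b}"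
  by (auto simp: pair_vec_def unit_vec_def)

lemma pair_vec_eq_iff:
  "a \<noteq> b \<Longrightarrow> a' \<noteq> b' \<Longrightarrow> pair_vec a b = pair_vec a' b' \<longleftrightarrow> {a, b} = {a', b'}"
  using pair_vec_supp[of a b] pair_vec_supp[of a' b'] pair_vec_commute[of a b]
  by (metis doubleton_eq_iff)

lemma dotp_pair_vec: "a \<in> {1..n} \<Longrightarrow> b \<in> {1..n} \<Longrightarrow> dotp n (pair_vec a b) w = w a + w b"
proof -
  assume "a \<in> {1..n}" "b \<in> {1..n}"
  moreover have "dotp n (pair_vec a b) w =
      (\<Sum>i\<in>{1..n}. if i = a then w i else 0) + (\<Sum>i\<in>{1..n}. if i = b then w i else 0)"
    unfolding dotp_def pair_vec_def unit_vec_def sum.distrib[symmetric] by (intro sum.cong) auto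
  ultimately show ?thesis by simp
qed

lemma pair_vec_hypersimplex2:
  "a \<in> {1..n} \<Longrightarrow> b \<in> {1..n} \<Longrightarrow> a \<noteq> b \<Longrightarrow> pair_vec a b \<in> hypersimplex2 n"
  using dotp_pair_vec[of a n b "\<lambda>_. 1"]
  by (auto simp: hypersimplex2_def dotp_def) (auto simp: pair_vec_def unit_vec_def)

lemma hs_supp_pair_vec: "a \<in> {1..n} \<Longrightarrow> b \<in> {1..n} \<Longrightarrow> a \<noteq> b \<Longrightarrow> hs_supp n (pair_vec a b) = {a, b}"
  using pair_vec_supp[of a b] by (auto simp: hs_supp_def)

lemma hs_vertex_iff:
  "hs_vertex n v \<longleftrightarrow> (\<exists>a b. a \<in> {1..n} \<and> b \<in> {1..n} \<and> a \<noteq> b \<and> v = pair_vec a b)"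
proof
  assume v: "hs_vertex n v"
  then obtain a b where ab: "hs_supp n v = {a, b}" "a \<noteq> b"
    by (auto simp: hs_vertex_def card_2_iff)
  have "v j = pair_vec a b j" for j
  proof (cases "j \<in> {1..n}")
    case True
    then have "v j = 0 \<or> v j = 1" "v j = 1 \<longleftrightarrow> j \<in> {a, b}"
      using v ab(1) by (auto simp: hs_vertex_def hs_supp_def)
    then show ?thesis using ab(2) by (auto simp: pair_vec_def unit_vec_def)
  next
    case False
    then have "j \<notin> {a, b}" using ab(1) by (auto simp: hs_supp_def)
    then show ?thesis using v False by (auto simp: pair_vec_def unit_vec_def hs_vertex_def)
  qed
  moreover have "a \<in> {1..n}" "b \<in> {1..n}" using ab(1) by (auto simp: hs_supp_def)
  ultimately show "\<exists>a b. a \<in> {1..n} \<and> b \<in> {1..n} \<and> a \<noteq> b \<and> v = pair_vec a b" using ab by blast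
next
  assume "\<exists>a b. a \<in> {1..n} \<and> b \<in> {1..n} \<and> a \<noteq> b \<and> v = pair_vec a b"
  then obtain a b where "a \<in> {1..n}" "b \<in> {1..n}" "a \<noteq> b" "v = pair_vec a b" by blast
  then have "card (hs_supp n v) = 2" "\<forall>i. v i = (if i = a \<or> i = b then 1 else 0)"
    "a \<in> {1..n}" "b \<in> {1..n}"
    using hs_supp_pair_vec[of a n b] by (auto simp: pair_vec_def unit_vec_def)
  then show "hs_vertex n v" by (auto simp: hs_vertex_def)
qed

lemma dotp_height: "dotp n x (height c \<omega> s) = (s, 1) \<bullet> proj n c \<omega> x"
  by (simp add: dotp_def height_def proj_def inner_prod_def distrib_left sum.distrib
      sum_distrib_left algebra_simps)

lemma dotp_le_top_pair:
  assumes x: "x \<in> hypersimplex2 n" and a: "a \<in> {1..n}"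
    and le: "\<And>l. l \<in> {1..n} - {a} \<Longrightarrow> w l \<le> w i" "w i \<le> w a"
  shows "dotp n x w \<le> w i + w a"
    and "dotp n x w = w i + w a \<Longrightarrow> w i < w a \<Longrightarrow> x a = 1"
    and "dotp n x w = w i + w a \<Longrightarrow> l \<in> {1..n} - {a} \<Longrightarrow> w l < w i \<Longrightarrow> x l = 0"
proof -
  have sum: "(\<Sum>l\<in>{1..n}. x l) = 2" and x01: "\<And>l. l \<in> {1..n} \<Longrightarrow> 0 \<le> x l \<and> x l \<le> 1"
    using x by (auto simp: hypersimplex2_def)
  have "(\<Sum>l\<in>{1..n}. x l * (w i - w l)) = 2 * w i - dotp n x w"
    using sum by (simp add: dotp_def right_diff_distrib sum_subtractf flip: sum_distrib_right)
  moreover have "(\<Sum>l\<in>{1..n}. x l * (w i - w l)) = (\<Sum>l\<in>{1..n} - {a}. x l * (w i - w l)) - x a * (w a - w i)"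
    by (subst sum.remove[OF _ a]) (simp_all add: algebra_simps)
  ultimately have *: "w i + w a - dotp n x w =
      (\<Sum>l\<in>{1..n} - {a}. x l * (w i - w l)) + (1 - x a) * (w a - w i)"
    by (simp add: algebra_simps)
  have nonneg: "0 \<le> x l * (w i - w l)" if "l \<in> {1..n} - {a}" for l
    using le(1)[OF that] x01 that by simp
  have S: "0 \<le> (\<Sum>l\<in>{1..n} - {a}. x l * (w i - w l))" using nonneg by (rule sum_nonneg)
  have T: "0 \<le> (1 - x a) * (w a - w i)" using x01[OF a] le(2) by simp
  show "dotp n x w \<le> w i + w a" using * S T by simp
  show "x a = 1" if "dotp n x w = w i + w a" "w i < w a"
    using * S T that by (auto simp: add_nonneg_eq_0_iff)
  show "x l = 0" if "dotp n x w = w i + w a" "l \<in> {1..n} - {a}" "w l < w i"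
  proof -
    have "(\<Sum>l\<in>{1..n} - {a}. x l * (w i - w l)) = 0" using * S T that(1) by (auto simp: add_nonneg_eq_0_iff)
    then have "x l * (w i - w l) = 0" using nonneg that(2) by (subst (asm) sum_nonneg_eq_0_iff) auto
    then show ?thesis using that(3) by simp
  qed
qed

lemma exchange_at_max:
  assumes ex: "exchange_at {1..n} c \<omega> s i j a" and a: "a \<in> {1..n}" and x: "x \<in> hypersimplex2 n"
  shows "(s, 1) \<bullet> proj n c \<omega> x \<le> height c \<omega> s j + height c \<omega> s a"
  using dotp_le_top_pair(1)[OF x a, of "height c \<omega> s" j] exchange_at_le[OF ex] ex
  by (auto simp: dotp_height[symmetric] exchange_at_def)

lemma vec_segment_pair_vec:
  "x \<in> vec_segment (pair_vec i a) (pair_vec j a) \<longleftrightarrow>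
     (\<exists>t. 0 \<le> t \<and> t \<le> 1 \<and> x = (\<lambda>l. (1 - t) * unit_vec i l + t * unit_vec j l + unit_vec a l))"
  unfolding vec_segment_def pair_vec_def by (auto simp: algebra_simps)

lemma exchange_at_face:
  assumes ex: "exchange_at {1..n} c \<omega> s i j a" and dist: "i \<noteq> j" "a \<noteq> i" "a \<noteq> j"
    and mem: "i \<in> {1..n}" "j \<in> {1..n}" "a \<in> {1..n}"
  shows "{x \<in> hypersimplex2 n. (s, 1) \<bullet> proj n c \<omega> x = height c \<omega> s j + height c \<omega> s a}
    = vec_segment (pair_vec i a) (pair_vec j a)"
proof (intro equalityI subsetI)
  fix x assume "x \<in> {x \<in> hypersimplex2 n. (s, 1) \<bullet> proj n c \<omega> x = height c \<omega> s j + height c \<omega> s a}"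
  then have x: "x \<in> hypersimplex2 n" and eq: "dotp n x (height c \<omega> s) = height c \<omega> s j + height c \<omega> s a"
    by (auto simp: dotp_height)
  note top = dotp_le_top_pair[OF x mem(3), of "height c \<omega> s" j]
  have xa: "x a = 1" using top(2) eq exchange_at_le[OF ex] ex by (auto simp: exchange_at_def)
  have x0: "x l = 0" if "l \<notin> {i, j, a}" for l
  proof (cases "l \<in> {1..n}")
    case True
    then show ?thesis using top(3)[of l] that eq exchange_at_le[OF ex] ex by (auto simp: exchange_at_def)
  qed (use x in \<open>auto simp: hypersimplex2_def\<close>)
  have "2 = (\<Sum>l\<in>{1..n}. x l)" using x by (simp add: hypersimplex2_def)
  also have "\<dots> = (\<Sum>l\<in>{i, j, a}. x l)" using mem x0 by (intro sum.mono_neutral_right) auto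
  also have "\<dots> = x i + x j + 1" using dist xa by simp
  finally have xi: "x i = 1 - x j" by simp
  have "0 \<le> x j" "x j \<le> 1" using x mem by (auto simp: hypersimplex2_def)
  moreover have "x = (\<lambda>l. (1 - x j) * unit_vec i l + x j * unit_vec j l + unit_vec a l)"
  proof
    fix l show "x l = (1 - x j) * unit_vec i l + x j * unit_vec j l + unit_vec a l"
      using xa xi x0[of l] dist by (cases "l \<in> {i, j, a}") (auto simp: unit_vec_def)
  qed
  ultimately show "x \<in> vec_segment (pair_vec i a) (pair_vec j a)"
    unfolding vec_segment_pair_vec by blast
next
  fix x assume "x \<in> vec_segment (pair_vec i a) (pair_vec j a)"
  then obtain t where t: "0 \<le> t" "t \<le> 1" and x: "x = (\<lambda>l. (1 - t) * pair_vec i a l + t * pair_vec j a l)"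
    by (auto simp: vec_segment_def)
  have dot: "dotp n x w = (1 - t) * w i + t * w j + w a" for w
  proof -
    have "dotp n x w = (1 - t) * dotp n (pair_vec i a) w + t * dotp n (pair_vec j a) w"
      by (simp add: x dotp_def sum.distrib sum_distrib_left distrib_right mult.assoc)
    then show ?thesis using mem by (simp add: dotp_pair_vec algebra_simps)
  qed
  have "x \<in> hypersimplex2 n"
    unfolding hypersimplex2_def
  proof (intro CollectI conjI ballI allI impI)
    show "(\<Sum>l\<in>{1..n}. x l) = 2" using dot[of "\<lambda>_. 1"] by (simp add: dotp_def)
    show "0 \<le> x l" "x l \<le> 1" for l using t dist by (auto simp: x pair_vec_def unit_vec_def)
    show "x l = 0" if "l \<notin> {1..n}" for l
      using that mem by (auto simp: x pair_vec_def unit_vec_def)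
  qed
  moreover have "dotp n x (height c \<omega> s) = height c \<omega> s j + height c \<omega> s a"
    using dot[of "height c \<omega> s"] ex by (simp add: exchange_at_def algebra_simps)
  ultimately show "x \<in> {x \<in> hypersimplex2 n. (s, 1) \<bullet> proj n c \<omega> x = height c \<omega> s j + height c \<omega> s a}"
    by (simp add: dotp_height)
qed

lemma convex_proj: "convex (proj n c \<omega> ` hypersimplex2 n)"
proof (rule convexI)
  fix p q and u v :: real
  assume "p \<in> proj n c \<omega> ` hypersimplex2 n" "q \<in> proj n c \<omega> ` hypersimplex2 n"
    and uv: "0 \<le> u" "0 \<le> v" "u + v = 1"
  then obtain x y where x: "x \<in> hypersimplex2 n" "p = proj n c \<omega> x"
    and y: "y \<in> hypersimplex2 n" "q = proj n c \<omega> y" by blast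
  let ?z = "\<lambda>i. u * x i + v * y i"
  have "(\<Sum>i\<in>{1..n}. ?z i) = u * (\<Sum>i\<in>{1..n}. x i) + v * (\<Sum>i\<in>{1..n}. y i)"
    by (simp add: sum.distrib sum_distrib_left)
  then have "(\<Sum>i\<in>{1..n}. ?z i) = 2"
    using x(1) y(1) uv(3) by (simp add: hypersimplex2_def flip: distrib_right)
  moreover have "0 \<le> ?z i \<and> ?z i \<le> 1" if "i \<in> {1..n}" for i
  proof -
    have "0 \<le> x i" "x i \<le> 1" "0 \<le> y i" "y i \<le> 1"
      using x(1) y(1) that by (auto simp: hypersimplex2_def)
    then show ?thesis using uv convex_bound_le[of "x i" 1 "y i" u v] by simp
  qed
  ultimately have "?z \<in> hypersimplex2 n" using x(1) y(1) unfolding hypersimplex2_def by simp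
  moreover have "dotp n ?z w = u * dotp n x w + v * dotp n y w" for w
    by (simp add: dotp_def sum.distrib sum_distrib_left distrib_right mult.assoc)
  then have "proj n c \<omega> ?z = u *\<^sub>R p + v *\<^sub>R q" using x y by (simp add: proj_def)
  ultimately show "u *\<^sub>R p + v *\<^sub>R q \<in> proj n c \<omega> ` hypersimplex2 n" 
    by (intro image_eqI[of _ _ ?z]) (simp_all only:)
qed

lemma pair_vec_in_segment: "pair_vec i a \<in> vec_segment (pair_vec i a) (pair_vec j a)"
    "pair_vec j a \<in> vec_segment (pair_vec i a) (pair_vec j a)"
proof -
  show "pair_vec i a \<in> vec_segment (pair_vec i a) (pair_vec j a)"
    unfolding vec_segment_def by (auto intro!: exI[of _ "0::real"])
  show "pair_vec j a \<in> vec_segment (pair_vec i a) (pair_vec j a)"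
    unfolding vec_segment_def by (auto intro!: exI[of _ "1::real"])
qed

lemma exchange_at_upper_edge:
  assumes ex: "exchange_at {1..n} c \<omega> s i j a" and dist: "i \<noteq> j" "a \<noteq> i" "a \<noteq> j"
    and mem: "i \<in> {1..n}" "j \<in> {1..n}" "a \<in> {1..n}" and c: "c i \<noteq> c j"
  defines "P \<equiv> proj n c \<omega> ` hypersimplex2 n"
  defines "F \<equiv> P \<inter> {p. (s, 1) \<bullet> p = height c \<omega> s j + height c \<omega> s a}"
  shows "upper_edge P F" and "hypersimplex2 n \<inter> proj n c \<omega> -` F = vec_segment (pair_vec i a) (pair_vec j a)"
proof -
  let ?M = "height c \<omega> s j + height c \<omega> s a"
  have le: "(s, 1) \<bullet> p \<le> ?M" if "p \<in> P" for p
    using that exchange_at_max[OF ex mem(3)] by (auto simp: P_def)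
  show seg: "hypersimplex2 n \<inter> proj n c \<omega> -` F = vec_segment (pair_vec i a) (pair_vec j a)"
    using exchange_at_face[OF ex dist mem] by (auto simp: F_def P_def)
  have face: "F face_of P"
    unfolding F_def using convex_proj le by (intro face_of_Int_supporting_hyperplane_le) (auto simp: P_def)
  have "{proj n c \<omega> (pair_vec i a), proj n c \<omega> (pair_vec j a)} \<subseteq> F"
    using seg pair_vec_in_segment by blast
  moreover have "proj n c \<omega> (pair_vec i a) \<noteq> proj n c \<omega> (pair_vec j a)"
    using c mem by (simp add: proj_def dotp_pair_vec)
  ultimately have "1 \<le> aff_dim F" by (metis aff_dim_subset aff_dim_2)
  moreover have "aff_dim F \<le> aff_dim {p. (s, 1 :: real) \<bullet> p = ?M}"
    by (intro aff_dim_subset) (auto simp: F_def)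
  then have "aff_dim F \<le> 1" by (simp add: aff_dim_hyperplane zero_prod_def)
  ultimately have "F edge_of P" using face by (simp add: edge_of_def)
  moreover have "proj n c \<omega> (pair_vec i j) \<in> P - F"
  proof -
    have "dotp n (pair_vec i j) (height c \<omega> s) < ?M"
      using ex mem by (simp add: dotp_pair_vec exchange_at_def)
    then show ?thesis
      using pair_vec_hypersimplex2[of i n j] mem dist by (auto simp: P_def F_def dotp_height)
  qed
  then have "F \<noteq> P" by blast
  moreover have "F \<noteq> {}" using \<open>1 \<le> aff_dim F\<close> by force
  moreover have "\<exists>u b. snd u > 0 \<and> P \<subseteq> {x. u \<bullet> x \<le> b} \<and> F = P \<inter> {x. u \<bullet> x = b}"
    using le by (intro exI[of _ "(s, 1)"] exI[of _ ?M]) (auto simp: F_def)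
  ultimately show "upper_edge P F" using face by (simp add: upper_edge_def upper_face_def)
qed

lemma upper_edge_normal:
  assumes "upper_edge P F"
  obtains s M p q where "P \<subseteq> {x. (s, 1) \<bullet> x \<le> M}" "F = P \<inter> {x. (s, 1) \<bullet> x = M}"
    "p \<in> F" "q \<in> F" "fst p < fst q"
proof -
  obtain u b where u: "snd u > 0" and P: "P \<subseteq> {x. u \<bullet> x \<le> b}" and F: "F = P \<inter> {x. u \<bullet> x = b}"
    using assms unfolding upper_edge_def upper_face_def by blast
  have scale: "u \<bullet> x = snd u * ((fst u / snd u, 1) \<bullet> x)" for x
    using u by (simp add: inner_prod_def field_simps)
  have P': "P \<subseteq> {x. (fst u / snd u, 1) \<bullet> x \<le> b / snd u}"
    using P u unfolding scale by (auto simp: field_simps)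
  have F': "F = P \<inter> {x. (fst u / snd u, 1) \<bullet> x = b / snd u}"
    using F u unfolding scale by (auto simp: field_simps)
  have dim: "aff_dim F = 1" using assms by (simp add: upper_edge_def edge_of_def)
  then have "F \<noteq> {}" "\<And>p. F \<noteq> {p}" by auto
  then obtain p q where pq: "p \<in> F" "q \<in> F" "p \<noteq> q" by blast
  then have "fst p \<noteq> fst q" using F' by (auto simp: inner_prod_def prod_eq_iff)
  then show thesis using that[OF P' F'] pq by (meson linorder_neqE_linordered_idom)
qed

lemma upper_edge_exchange_at:
  assumes edge: "upper_edge (proj n c \<omega> ` hypersimplex2 n) F"
    and seg: "hypersimplex2 n \<inter> proj n c \<omega> -` F = vec_segment (pair_vec i a) (pair_vec j a)"
    and dist: "i \<noteq> j" "a \<noteq> i" "a \<noteq> j" and mem: "i \<in> {1..n}" "j \<in> {1..n}" "a \<in> {1..n}"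
  shows "\<exists>s. exchange_at {1..n} c \<omega> s i j a"
proof -
  obtain s M where P: "proj n c \<omega> ` hypersimplex2 n \<subseteq> {x. (s, 1) \<bullet> x \<le> M}"
    and F: "F = proj n c \<omega> ` hypersimplex2 n \<inter> {x. (s, 1) \<bullet> x = M}"
    using upper_edge_normal[OF edge] by metis
  let ?h = "height c \<omega> s"
  have seg_iff: "x \<in> vec_segment (pair_vec i a) (pair_vec j a) \<longleftrightarrow> dotp n x ?h = M"
    if "x \<in> hypersimplex2 n" for x
    using that seg unfolding F by (auto simp: dotp_height)
  have le: "dotp n x ?h \<le> M" if "x \<in> hypersimplex2 n" for x
    using that P by (auto simp: dotp_height)
  have eq: "?h i + ?h a = M" "?h j + ?h a = M"
    using seg_iff[of "pair_vec i a"] seg_iff[of "pair_vec j a"] pair_vec_in_segment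
      pair_vec_hypersimplex2 dist mem by (metis dotp_pair_vec)+
  have less: "?h k + ?h l < M"
    if "k \<in> {1..n}" "l \<in> {1..n}" "k \<noteq> l" "pair_vec k l \<notin> vec_segment (pair_vec i a) (pair_vec j a)" for k l
    using seg_iff[of "pair_vec k l"] le[of "pair_vec k l"] pair_vec_hypersimplex2[of k n l] that
    by (simp add: dotp_pair_vec)
  have "?h i + ?h j < M"
  proof (rule less)
    show "pair_vec i j \<notin> vec_segment (pair_vec i a) (pair_vec j a)"
    proof
      assume "pair_vec i j \<in> vec_segment (pair_vec i a) (pair_vec j a)"
      then obtain t where "pair_vec i j = (\<lambda>l. (1 - t) * pair_vec i a l + t * pair_vec j a l)"
        by (auto simp: vec_segment_def)
      from fun_cong[OF this, of a] show False using dist by (simp add: pair_vec_def unit_vec_def)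
    qed
  qed (use mem dist in auto)
  moreover have "?h l < ?h j" if l: "l \<in> {1..n} - {i, j, a}" for l
  proof -
    have "?h l + ?h a < M"
    proof (rule less)
      show "pair_vec l a \<notin> vec_segment (pair_vec i a) (pair_vec j a)"
      proof
        assume "pair_vec l a \<in> vec_segment (pair_vec i a) (pair_vec j a)"
        then obtain t where "pair_vec l a = (\<lambda>l. (1 - t) * pair_vec i a l + t * pair_vec j a l)"
          by (auto simp: vec_segment_def)
        from fun_cong[OF this, of l] show False using l by (simp add: pair_vec_def unit_vec_def)
      qed
    qed (use l mem in auto)
    then show ?thesis using eq by simp
  qed
  ultimately have "exchange_at {1..n} c \<omega> s i j a" using eq by (auto simp: exchange_at_def)
  then show ?thesis by blast
qed

section \<open>Lattice paths\<close>

definition lattice_step :: "nat \<times> nat \<Rightarrow> nat \<times> nat \<Rightarrow> bool" where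
  "lattice_step p q \<longleftrightarrow> (fst p < fst q \<and> snd p = snd q) \<or> (fst p = fst q \<and> snd p < snd q)"

definition lattice_vertex :: "nat \<times> nat \<Rightarrow> nat \<Rightarrow> real" where
  "lattice_vertex p = pair_vec (fst p) (snd p)"

definition off_diagonal :: "nat \<Rightarrow> (nat \<times> nat) set" where
  "off_diagonal n = {p \<in> {1..n} \<times> {1..n}. fst p \<noteq> snd p}"

lemma diagonal_avoiding_path_iff:
  "diagonal_avoiding_path n ls \<longleftrightarrow> ls \<noteq> [] \<and> hd ls = (2, 1) \<and> last ls \<in> {(n - 1, n), (n, n - 1)} \<and>
     set ls \<subseteq> off_diagonal n \<and> (\<forall>q. Suc q < length ls \<longrightarrow> lattice_step (ls ! q) (ls ! Suc q))"
  by (auto simp: diagonal_avoiding_path_def lattice_step_def off_diagonal_def)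

lemma lattice_vertex_eq_iff:
  "p \<in> off_diagonal n \<Longrightarrow> q \<in> off_diagonal n \<Longrightarrow>
     lattice_vertex p = lattice_vertex q \<longleftrightarrow> {fst p, snd p} = {fst q, snd q}"
  by (simp add: lattice_vertex_def off_diagonal_def pair_vec_eq_iff)

lemma lattice_step_vertex_inj:
  assumes "lattice_step p q" "lattice_step p q'" "lattice_vertex q = lattice_vertex q'"
    and "p \<in> off_diagonal n" "q \<in> off_diagonal n" "q' \<in> off_diagonal n"
  shows "q = q'"
proof -
  have "{fst q, snd q} = {fst q', snd q'}" using assms lattice_vertex_eq_iff by blast
  then show ?thesis using assms(1,2,4)
    by (auto simp: lattice_step_def off_diagonal_def doubleton_eq_iff prod_eq_iff)
qed

lemma lattice_step_enhanced:
  assumes "lattice_step (ls ! q) (ls ! Suc q)" "ls ! q \<in> off_diagonal n" "ls ! Suc q \<in> off_diagonal n"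
    and "enhanced_step ls q = (i, j, a)"
  shows "i < j" "a \<noteq> i" "a \<noteq> j" "i \<in> {1..n}" "j \<in> {1..n}" "a \<in> {1..n}"
    "{fst (ls ! q), snd (ls ! q)} = {i, a}" "{fst (ls ! Suc q), snd (ls ! Suc q)} = {j, a}"
    "lattice_vertex (ls ! q) = pair_vec i a" "lattice_vertex (ls ! Suc q) = pair_vec j a"
  using assms
  by (auto simp: lattice_step_def off_diagonal_def enhanced_step_def lattice_vertex_def
      pair_vec_commute[of a] split: if_splits)

lemma inj_on_lattice_vertex: "inj_on (map lattice_vertex) {ls. diagonal_avoiding_path n ls}"
proof (rule inj_onI)
  fix ls ls' assume "ls \<in> {ls. diagonal_avoiding_path n ls}" "ls' \<in> {ls. diagonal_avoiding_path n ls}"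
    and eq: "map lattice_vertex ls = map lattice_vertex ls'"
  then have ls: "diagonal_avoiding_path n ls" "diagonal_avoiding_path n ls'" by auto
  have len: "length ls = length ls'" using eq map_eq_imp_length_eq by blast
  have off: "ls ! q \<in> off_diagonal n" "ls' ! q \<in> off_diagonal n" if "q < length ls" for q
    using ls that len nth_mem unfolding diagonal_avoiding_path_iff by (metis subsetD)+
  have "ls ! q = ls' ! q" if "q < length ls" for q
    using that
  proof (induction q)
    case 0
    then show ?case using ls len unfolding diagonal_avoiding_path_iff by (metis hd_conv_nth)
  next
    case (Suc q)
    have "lattice_vertex (ls ! Suc q) = lattice_vertex (ls' ! Suc q)"
      using arg_cong[OF eq, of "\<lambda>xs. xs ! Suc q"] Suc.prems len by simp
    moreover have "lattice_step (ls ! q) (ls ! Suc q)" "lattice_step (ls ! q) (ls' ! Suc q)"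
      using Suc ls len unfolding diagonal_avoiding_path_iff by auto
    ultimately show ?case using lattice_step_vertex_inj off Suc.prems by (meson Suc_lessD)
  qed
  then show "ls = ls'" using len nth_equalityI by blast
qed

context
  fixes n :: nat and c :: "nat \<Rightarrow> real"
  assumes n: "n \<ge> 3" and c: "strict_mono_on {1..n} c"
begin

lemma c_strict_less: "i \<in> {1..n} \<Longrightarrow> j \<in> {1..n} \<Longrightarrow> i < j \<Longrightarrow> c i < c j"
  using c by (simp add: strict_mono_on_def)

lemma c_le: "i \<in> {1..n} \<Longrightarrow> j \<in> {1..n} \<Longrightarrow> i \<le> j \<Longrightarrow> c i \<le> c j"
  using c_strict_less[of i j] by (cases "i = j") auto

lemma dotp_bounds:
  assumes x: "x \<in> hypersimplex2 n"
  shows "c 1 + c 2 \<le> dotp n x c" and "dotp n x c \<le> c (n - 1) + c n"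
proof -
  have "dotp n x (\<lambda>l. - c l) \<le> - c 2 + - c 1"
    by (rule dotp_le_top_pair(1)[OF x]) (use n in \<open>auto intro!: c_le\<close>)
  then show "c 1 + c 2 \<le> dotp n x c" by (simp add: dotp_def sum_negf)
  show "dotp n x c \<le> c (n - 1) + c n"
    by (rule dotp_le_top_pair(1)[OF x]) (use n in \<open>auto intro!: c_le\<close>)
qed

lemma monotone_path_lattice:
  assumes ls: "diagonal_avoiding_path n ls"
  shows "monotone_path n c (map lattice_vertex ls)"
  unfolding monotone_path_def
proof (intro conjI ballI allI impI)
  have ne: "ls \<noteq> []" and last: "last ls \<in> {(n - 1, n), (n, n - 1)}"
    and off: "\<And>p. p \<in> set ls \<Longrightarrow> p \<in> off_diagonal n"
    using ls unfolding diagonal_avoiding_path_iff by auto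
  show "map lattice_vertex ls \<noteq> []" using ne by simp
  show "hd (map lattice_vertex ls) = (\<lambda>j. unit_vec 1 j + unit_vec 2 j)"
    using ls ne unfolding diagonal_avoiding_path_iff
    by (simp add: hd_map lattice_vertex_def pair_vec_def add.commute)
  show "last (map lattice_vertex ls) = (\<lambda>j. unit_vec (n - 1) j + unit_vec n j)"
    using last ne by (auto simp: last_map lattice_vertex_def pair_vec_def)
  fix v assume "v \<in> set (map lattice_vertex ls)"
  then show "hs_vertex n v"
    using off by (fastforce simp: hs_vertex_iff lattice_vertex_def off_diagonal_def)
next
  fix q assume "Suc q < length (map lattice_vertex ls)"
  then have q: "Suc q < length ls" by simp
  then have step: "lattice_step (ls ! q) (ls ! Suc q)" "ls ! q \<in> off_diagonal n" "ls ! Suc q \<in> off_diagonal n"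
    using ls nth_mem[of q ls] nth_mem[of "Suc q" ls] unfolding diagonal_avoiding_path_iff by auto
  obtain i j a where e: "enhanced_step ls q = (i, j, a)" using prod_cases3 by blast
  note s = lattice_step_enhanced[OF step e]
  have "hs_adjacent n (pair_vec i a) (pair_vec j a)"
  proof -
    have "hs_vertex n (pair_vec i a)" "hs_vertex n (pair_vec j a)"
      unfolding hs_vertex_iff using s(2-6) by metis+
    moreover have "{i, a} \<inter> {j, a} = {a}" using s by auto
    ultimately show ?thesis using s by (simp add: hs_adjacent_def hs_supp_pair_vec)
  qed
  then show "hs_adjacent n (map lattice_vertex ls ! q) (map lattice_vertex ls ! Suc q)"
    using q s by simp
  show "dotp n (map lattice_vertex ls ! q) c < dotp n (map lattice_vertex ls ! Suc q) c"
    using q s c_strict_less[of i j] by (simp add: dotp_pair_vec)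
qed

lemma adjacent_lattice_step:
  assumes adj: "hs_adjacent n (lattice_vertex p) v" and less: "dotp n (lattice_vertex p) c < dotp n v c"
    and p: "p \<in> off_diagonal n"
  obtains p' where "p' \<in> off_diagonal n" "lattice_step p p'" "lattice_vertex p' = v"
proof -
  obtain a b where ab: "p = (a, b)" "a \<in> {1..n}" "b \<in> {1..n}" "a \<noteq> b"
    using p by (cases p) (auto simp: off_diagonal_def)
  obtain a' b' where v: "a' \<in> {1..n}" "b' \<in> {1..n}" "a' \<noteq> b'" "v = pair_vec a' b'"
    using adj by (auto simp: hs_adjacent_def hs_vertex_iff)
  have card: "card ({a, b} \<inter> {a', b'}) = 1"
    using adj ab v by (simp add: hs_adjacent_def lattice_vertex_def hs_supp_pair_vec)
  have "\<exists>d\<in>{1..n}. d \<noteq> a \<and> d \<noteq> b \<and> (v = pair_vec d b \<or> v = pair_vec a d)"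
  proof -
    have "{a, b} \<inter> {a', b'} \<noteq> {}" "{a, b} \<inter> {a', b'} \<noteq> {a', b'}"
      using card v(3) by (metis card.empty zero_neq_one, metis card_2_iff numeral_eq_one_iff semiring_norm(85))
    then have "a' \<in> {a, b} \<or> b' \<in> {a, b}" "\<not> (a' \<in> {a, b} \<and> b' \<in> {a, b})"
      by blast+
    then show ?thesis using v pair_vec_commute[of a' b'] by auto
  qed
  then obtain d where d: "d \<in> {1..n}" "d \<noteq> a" "d \<noteq> b" "v = pair_vec d b \<or> v = pair_vec a d" by blast
  then consider "v = pair_vec d b" | "v = pair_vec a d" by blast
  then show thesis
  proof cases
    case 1
    then have "c a < c d" using less ab d by (simp add: lattice_vertex_def dotp_pair_vec)
    then have "a < d" using c_le[of d a] ab d by (meson linorder_not_less)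
    then show thesis using that[of "(d, b)"] 1 ab d by (simp add: off_diagonal_def lattice_step_def lattice_vertex_def)
  next
    case 2
    then have "c b < c d" using less ab d by (simp add: lattice_vertex_def dotp_pair_vec)
    then have "b < d" using c_le[of d b] ab d by (meson linorder_not_less)
    then show thesis using that[of "(a, d)"] 2 ab d by (simp add: off_diagonal_def lattice_step_def lattice_vertex_def)
  qed
qed

lemma monotone_path_surj:
  assumes vs: "monotone_path n c vs"
  shows "\<exists>ls. diagonal_avoiding_path n ls \<and> map lattice_vertex ls = vs"
proof -
  define good where "good ls k \<longleftrightarrow> length ls = Suc k \<and> ls ! 0 = (2, 1) \<and>
    (\<forall>q\<le>k. ls ! q \<in> off_diagonal n \<and> lattice_vertex (ls ! q) = vs ! q) \<and>
    (\<forall>q<k. lattice_step (ls ! q) (ls ! Suc q))" for ls k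
  have ne: "vs \<noteq> []" using vs by (simp add: monotone_path_def)
  have "k < length vs \<Longrightarrow> \<exists>ls. good ls k" for k
  proof (induction k)
    case 0
    have "vs ! 0 = pair_vec 2 1"
      using vs ne by (simp add: monotone_path_def hd_conv_nth pair_vec_def add.commute)
    then have "good [(2, 1)] 0" using n by (simp add: good_def off_diagonal_def lattice_vertex_def)
    then show ?case by blast
  next
    case (Suc k)
    then obtain ls where ls: "good ls k" by auto
    have "hs_adjacent n (vs ! k) (vs ! Suc k)" "dotp n (vs ! k) c < dotp n (vs ! Suc k) c"
      using vs Suc.prems by (auto simp: monotone_path_def)
    then obtain p where p: "p \<in> off_diagonal n" "lattice_step (ls ! k) p" "lattice_vertex p = vs ! Suc k"
      using adjacent_lattice_step[of "ls ! k"] ls by (auto simp: good_def)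
    then have "good (ls @ [p]) (Suc k)"
      using ls unfolding good_def by (auto simp: nth_append le_Suc_eq less_Suc_eq)
    then show ?case by blast
  qed
  then obtain ls where ls: "good ls (length vs - 1)" using ne by (meson diff_less length_greater_0_conv zero_less_one)
  then have len: "length ls = length vs" "ls \<noteq> []" using ne by (auto simp: good_def)
  have map: "map lattice_vertex ls = vs"
    using ls len by (intro nth_equalityI) (auto simp: good_def)
  have off: "set ls \<subseteq> off_diagonal n"
  proof
    fix p assume "p \<in> set ls"
    then obtain q where "q < length ls" "p = ls ! q" by (metis in_set_conv_nth)
    then show "p \<in> off_diagonal n" using ls by (simp add: good_def)
  qed
  have "last ls \<in> off_diagonal n" using off len by auto
  moreover have "lattice_vertex (last ls) = pair_vec (n - 1) n"
    using vs last_map[OF len(2), of lattice_vertex] map by (simp add: monotone_path_def pair_vec_def)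
  ultimately have "{fst (last ls), snd (last ls)} = {n - 1, n}"
    using n by (simp add: lattice_vertex_def off_diagonal_def pair_vec_eq_iff)
  then have "last ls \<in> {(n - 1, n), (n, n - 1)}"
    by (cases "last ls") (auto simp: doubleton_eq_iff)
  then have "diagonal_avoiding_path n ls"
    using ls len off unfolding diagonal_avoiding_path_iff good_def by (auto simp: hd_conv_nth)
  then show ?thesis using map by blast
qed

definition exchange_times :: "(nat \<Rightarrow> real) \<Rightarrow> (nat \<Rightarrow> real) \<Rightarrow> (nat \<times> nat) list \<Rightarrow> bool" where
  "exchange_times \<omega> s ls \<longleftrightarrow> (\<forall>q i j a. Suc q < length ls \<longrightarrow> enhanced_step ls q = (i, j, a) \<longrightarrow>
     exchange_at {1..n} c \<omega> (s q) i j a)"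

context
  fixes ls :: "(nat \<times> nat) list"
  assumes ls: "diagonal_avoiding_path n ls"
begin

lemma path_facts: "ls \<noteq> []" "hd ls = (2, 1)" "last ls \<in> {(n - 1, n), (n, n - 1)}"
  "q < length ls \<Longrightarrow> ls ! q \<in> off_diagonal n"
  using ls nth_mem[of q ls] unfolding diagonal_avoiding_path_iff by auto

lemma enhanced_step_facts:
  assumes "Suc q < length ls" "enhanced_step ls q = (i, j, a)"
  shows "i < j" "a \<noteq> i" "a \<noteq> j" "i \<in> {1..n}" "j \<in> {1..n}" "a \<in> {1..n}"
    "{fst (ls ! q), snd (ls ! q)} = {i, a}" "{fst (ls ! Suc q), snd (ls ! Suc q)} = {j, a}"
    "lattice_vertex (ls ! q) = pair_vec i a" "lattice_vertex (ls ! Suc q) = pair_vec j a"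
  using lattice_step_enhanced[of ls q n i j a] path_facts(4)[of q] path_facts(4)[of "Suc q"] assms ls
  unfolding diagonal_avoiding_path_iff by auto

lemma enhanced_next:
  assumes "Suc (Suc q) < length ls" "enhanced_step ls q = (i, j, a)" "enhanced_step ls (Suc q) = (x, y, z)"
  shows "(x = j \<and> z = a) \<or> (x = a \<and> z = j)"
  using enhanced_step_facts(8)[OF _ assms(2)] enhanced_step_facts(7)[OF assms(1,3)] assms(1) by (auto simp: doubleton_eq_iff)

lemma path_length_ge_2: "2 \<le> length ls"
proof (rule ccontr)
  assume "\<not> ?thesis"
  then have "length ls = Suc 0" using path_facts(1) length_0_conv[of ls] by linarith
  then have "hd ls = last ls" by (auto simp: length_Suc_conv)
  then show False using path_facts n by auto
qed

lemma exchange_times_increasing: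
  assumes T: "exchange_times \<omega> s ls" and pq: "p < q" "Suc q < length ls"
  shows "s p < s q"
  using pq
proof (induction q rule: less_Suc_induct)
  case (1 q)
  obtain i j a where e: "enhanced_step ls q = (i, j, a)" using prod_cases3 by blast
  obtain x y z where e': "enhanced_step ls (Suc q) = (x, y, z)" using prod_cases3 by blast
  have ex: "exchange_at {1..n} c \<omega> (s q) i j a" "exchange_at {1..n} c \<omega> (s (Suc q)) x y z"
    using T 1 e e' by (auto simp: exchange_times_def)
  note en = enhanced_step_facts[OF _ e] enhanced_step_facts[OF _ e']
  have xy: "c x < c y" using c_strict_less en 1 by auto
  have eq: "height c \<omega> (s (Suc q)) x = height c \<omega> (s (Suc q)) y"
    using ex(2) by (simp add: exchange_at_def)
  have "(x = j \<and> z = a) \<or> (x = a \<and> z = j)" using enhanced_next[OF _ e e'] 1 by simp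
  then have "height c \<omega> (s q) y < height c \<omega> (s q) x"
  proof (elim disjE conjE)
    assume "x = j" "z = a"
    then have "y \<in> {1..n} - {i, j, a}" using en 1 by auto
    then show ?thesis using ex(1) \<open>x = j\<close> by (simp add: exchange_at_def)
  next
    assume xz: "x = a" "z = j"
    then have "y \<noteq> a" "y \<in> {1..n}" using en 1 by auto
    then show ?thesis using exchange_at_le[OF ex(1)] ex(1) xz by (fastforce simp: exchange_at_def)
  qed
  then show ?case
    using height_less_forward[of c \<omega> "s (Suc q)" x y "s q"] xy eq by (metis linorder_cases order_refl less_asym)
next
  case (2 p q r)
  then show ?case by simp
qed

lemma exchange_times_coherent_lattice:
  assumes T: "exchange_times \<omega> s ls"
  shows "coherent_lattice_path n ls"
  unfolding coherent_lattice_path_def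
proof (intro conjI allI impI ls, elim conjE)
  fix p q i j a x y z
  assume p: "p < q" "Suc q < length ls" "enhanced_step ls p = (i, j, a)" "enhanced_step ls q = (x, y, z)" "x < j"
  have "exchange_at {1..n} c \<omega> (s p) i j a" "exchange_at {1..n} c \<omega> (s q) x y z"
    using T p by (auto simp: exchange_times_def)
  then show "j = z \<or> x = a"
    using exchange_times_increasing[OF T p(1,2)] c
  proof (rule exchange_at_coherent)
    show "j \<in> {1..n}" using enhanced_step_facts(5)[OF _ p(3)] p(1,2) by simp
    show "x \<in> {1..n}" using enhanced_step_facts(4)[OF p(2,4)] .
  qed (fact p(5))
qed

lemma coherent_monotone_exchange_times:
  assumes "coherent_monotone_path n c (map lattice_vertex ls)"
  shows "\<exists>\<omega> s. exchange_times \<omega> s ls"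
proof -
  let ?vs = "map lattice_vertex ls"
  obtain \<omega> where \<omega>: "{hypersimplex2 n \<inter> proj n c \<omega> -` F | F. upper_edge (proj n c \<omega> ` hypersimplex2 n) F}
      = {vec_segment (?vs ! i) (?vs ! Suc i) | i. Suc i < length ?vs}"
    using assms unfolding coherent_monotone_path_def by blast
  have "\<exists>s. \<forall>i j a. Suc q < length ls \<longrightarrow> enhanced_step ls q = (i, j, a) \<longrightarrow> exchange_at {1..n} c \<omega> s i j a" for q
  proof (cases "Suc q < length ls")
    case q: True
    obtain i j a where e: "enhanced_step ls q = (i, j, a)" using prod_cases3 by blast
    note en = enhanced_step_facts[OF q e]
    have "vec_segment (?vs ! q) (?vs ! Suc q) \<in> {vec_segment (?vs ! i) (?vs ! Suc i) | i. Suc i < length ?vs}"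
      using q by (intro CollectI exI[of _ q]) simp
    then obtain F where "upper_edge (proj n c \<omega> ` hypersimplex2 n) F"
      "hypersimplex2 n \<inter> proj n c \<omega> -` F = vec_segment (?vs ! q) (?vs ! Suc q)"
      unfolding \<omega>[symmetric] by blast
    then have "\<exists>s. exchange_at {1..n} c \<omega> s i j a"
      using upper_edge_exchange_at[of n c \<omega> F i a j] en q by simp
    then show ?thesis using e by auto
  qed simp
  then show ?thesis unfolding exchange_times_def by metis
qed

lemma exchange_times_coherent_monotone:
  assumes T: "exchange_times \<omega> s ls"
  shows "coherent_monotone_path n c (map lattice_vertex ls)"
proof -
  let ?vs = "map lattice_vertex ls"
  define P where "P = proj n c \<omega> ` hypersimplex2 n"
  define p where "p q = proj n c \<omega> (lattice_vertex (ls ! q))" for q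
  define M where "M q = (s q, 1) \<bullet> p q" for q
  have step: "upper_edge P (P \<inter> {x. (s q, 1) \<bullet> x = M q}) \<and>
      hypersimplex2 n \<inter> proj n c \<omega> -` (P \<inter> {x. (s q, 1) \<bullet> x = M q}) = vec_segment (?vs ! q) (?vs ! Suc q) \<and>
      (\<forall>x\<in>P. (s q, 1) \<bullet> x \<le> M q) \<and> (s q, 1) \<bullet> p (Suc q) = M q"
    if q: "Suc q < length ls" for q
  proof -
    obtain i j a where e: "enhanced_step ls q = (i, j, a)" using prod_cases3 by blast
    note en = enhanced_step_facts[OF q e]
    have ex: "exchange_at {1..n} c \<omega> (s q) i j a" using T q e by (auto simp: exchange_times_def)
    have M: "M q = height c \<omega> (s q) j + height c \<omega> (s q) a"
      using en ex unfolding M_def p_def dotp_height[symmetric] by (simp add: dotp_pair_vec exchange_at_def)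
    moreover have "(s q, 1) \<bullet> p (Suc q) = height c \<omega> (s q) j + height c \<omega> (s q) a"
      using en unfolding p_def dotp_height[symmetric] by (simp add: dotp_pair_vec)
    moreover have "c i \<noteq> c j" using c_strict_less[of i j] en by auto
    ultimately show ?thesis
      using exchange_at_upper_edge[OF ex] exchange_at_max[OF ex] en q by (auto simp: P_def)
  qed
  have p_mem: "p q \<in> P" if "q < length ls" for q
    using path_facts(4)[OF that] by (auto simp: p_def P_def lattice_vertex_def off_diagonal_def intro!: imageI pair_vec_hypersimplex2)
  have p_first: "fst (p 0) \<le> fst x" and p_last: "fst x \<le> fst (p (length ls - 1))" if "x \<in> P" for x
  proof -
    have "ls ! 0 = (2, 1)" "ls ! (length ls - 1) \<in> {(n - 1, n), (n, n - 1)}"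
      using path_facts by (metis hd_conv_nth, metis last_conv_nth)
    then show "fst (p 0) \<le> fst x" "fst x \<le> fst (p (length ls - 1))"
      using that n dotp_bounds by (auto simp: p_def P_def proj_def lattice_vertex_def dotp_pair_vec add.commute)
  qed
  have all: "\<exists>q. Suc q < length ls \<and> F = P \<inter> {x. (s q, 1) \<bullet> x = M q}" if F: "upper_edge P F" for F
  proof -
    obtain t m x y where t: "P \<subseteq> {x. (t, 1) \<bullet> x \<le> m}" "F = P \<inter> {x. (t, 1) \<bullet> x = m}"
      and xy: "x \<in> F" "y \<in> F" "fst x < fst y"
      using upper_edge_normal[OF F] by metis
    have "\<exists>q. Suc q < length ls \<and> t = s q"
    proof (rule ccontr)
      assume "\<not> ?thesis"
      then have neq: "\<And>q. Suc q < length ls \<Longrightarrow> s q \<noteq> t" by blast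
      have after: "fst (p (Suc q)) \<le> fst x" if q: "Suc q < length ls" "s q < t" and x: "x \<in> F" for q x
      proof -
        have "(s q, 1) \<bullet> x \<le> (s q, 1) \<bullet> p (Suc q)" using step[OF q(1)] x t(2) by auto
        moreover have "(t, 1) \<bullet> p (Suc q) \<le> (t, 1) \<bullet> x" using t p_mem[OF q(1)] x by auto
        ultimately have "(t - s q) * fst (p (Suc q)) \<le> (t - s q) * fst x"
          by (simp add: inner_prod_def algebra_simps)
        then show ?thesis using q(2) by simp
      qed
      have before: "fst x \<le> fst (p q)" if q: "Suc q < length ls" "t < s q" and x: "x \<in> F" for q x
      proof -
        have "(s q, 1) \<bullet> x \<le> (s q, 1) \<bullet> p q" using step[OF q(1)] x t(2) by (auto simp: M_def)
        moreover have "(t, 1) \<bullet> p q \<le> (t, 1) \<bullet> x" using t p_mem[of q] q(1) x by auto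
        ultimately have "(s q - t) * fst x \<le> (s q - t) * fst (p q)"
          by (simp add: inner_prod_def algebra_simps)
        then show ?thesis using q(2) by simp
      qed
      define later where "later q \<longleftrightarrow> Suc q < length ls \<longrightarrow> t < s q" for q
      define q where "q = (LEAST q. later q)"
      have later: "later (length ls - 1)" using path_length_ge_2 by (auto simp: later_def)
      have q: "later q" "q \<le> length ls - 1" "\<And>q'. q' < q \<Longrightarrow> \<not> later q'"
        unfolding q_def using LeastI[of later, OF later] Least_le[of later, OF later] not_less_Least[of _ later]
        by blast+
      have "fst (p q) \<le> fst x"
      proof (cases q)
        case 0
        then show ?thesis using p_first xy(1) t(2) by auto
      next
        case (Suc q')
        then have "Suc q' < length ls" "\<not> t < s q'" using q(3)[of q'] by (auto simp: later_def)
        then show ?thesis using after[of q' x] xy(1) neq[of q'] Suc by force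
      qed
      moreover have "fst y \<le> fst (p q)"
      proof (cases "Suc q < length ls")
        case True
        then show ?thesis using before xy(2) q(1) by (auto simp: later_def)
      next
        case False
        then have "q = length ls - 1" using q(2) by simp
        then show ?thesis using p_last xy(2) t(2) by auto
      qed
      ultimately show False using xy(3) by simp
    qed
    then obtain q where q: "Suc q < length ls" "t = s q" by blast
    have "M q \<le> m" using t(1) p_mem[of q] q by (auto simp: M_def)
    moreover have "m \<le> M q" using step[OF q(1)] xy(1) t(2) q(2) by auto
    ultimately show ?thesis using t(2) q by auto
  qed
  have "{hypersimplex2 n \<inter> proj n c \<omega> -` F | F. upper_edge P F}
      = {vec_segment (?vs ! i) (?vs ! Suc i) | i. Suc i < length ?vs}" (is "?L = ?R")
  proof (intro equalityI subsetI)
    fix S assume "S \<in> ?L"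
    then obtain F where F: "upper_edge P F" "S = hypersimplex2 n \<inter> proj n c \<omega> -` F" by blast
    then obtain q where q: "Suc q < length ls" "F = P \<inter> {x. (s q, 1) \<bullet> x = M q}" using all by blast
    have "S = vec_segment (?vs ! q) (?vs ! Suc q)"
      unfolding F(2) q(2) using step[OF q(1)] by blast
    then show "S \<in> ?R" using q(1) by (intro CollectI exI[of _ q]) simp
  next
    fix S assume "S \<in> ?R"
    then obtain q where "Suc q < length ls" "S = vec_segment (?vs ! q) (?vs ! Suc q)" by auto
    then show "S \<in> ?L" using step[of q] by blast
  qed
  then show ?thesis
    using monotone_path_lattice[OF ls] unfolding coherent_monotone_path_def P_def by blast
qed

lemma coherent_lattice_exchange_times:
  assumes coh: "coherent_lattice_path n ls"
  shows "\<exists>\<omega> s. exchange_times \<omega> s ls"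
proof -
  define r where "r = length ls - 1"
  define I where "I m = (case m of 0 \<Rightarrow> 0 | Suc q \<Rightarrow> fst (enhanced_step ls q))" for m
  define J where "J m = (case m of 0 \<Rightarrow> 2 | Suc q \<Rightarrow> fst (snd (enhanced_step ls q)))" for m
  define A where "A m = (case m of 0 \<Rightarrow> 1 | Suc q \<Rightarrow> snd (snd (enhanced_step ls q)))" for m
  have e: "enhanced_step ls q = (I (Suc q), J (Suc q), A (Suc q))" for q
    by (simp add: I_def J_def A_def)
  have zero: "I 0 = 0" "J 0 = 2" "A 0 = 1" by (simp_all add: I_def J_def A_def)
  have r: "Suc q < length ls" if "Suc q \<le> r" for q using that by (simp add: r_def)
  note en = enhanced_step_facts[OF r e]
  interpret coherent_step_sequence n r I J A
  proof unfold_locales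
    show "I 0 = 0" "J 0 = 2" "A 0 = 1" by (fact zero)+
    show "I m < J m" "A m \<noteq> I m \<and> A m \<noteq> J m" "J m \<le> n \<and> A m \<le> n" if "m \<le> r" for m
      using that en zero n by (cases m; auto)+
    show "(I (Suc m) = J m \<and> A (Suc m) = A m) \<or> (I (Suc m) = A m \<and> A (Suc m) = J m)" if "m < r" for m
    proof (cases m)
      case 0
      have "ls ! 0 = (2, 1)" using path_facts by (metis hd_conv_nth)
      then show ?thesis using en(7)[of 0] that zero 0 by (auto simp: doubleton_eq_iff)
    next
      case (Suc q)
      then show ?thesis using enhanced_next[OF _ e e] r[of "Suc q"] that by simp
    qed
    have "r \<noteq> 0" using path_length_ge_2 by (simp add: r_def)
    then obtain q where q: "r = Suc q" using not0_implies_Suc by blast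
    have "ls ! r = last ls" using path_facts(1) by (simp add: r_def last_conv_nth)
    moreover have "{fst (last ls), snd (last ls)} = {n - 1, n}"
      using path_facts(3) by (elim insertE) (simp_all add: insert_commute)
    moreover have "{fst (ls ! r), snd (ls ! r)} = {J r, A r}" using en(8)[of q] q by simp
    ultimately show "{J r, A r} = {n - 1, n}" by simp
    show "J p = A q \<or> I q = A p" if pq: "p < q" "q \<le> r" "I q < J p" for p q
    proof -
      obtain q' where q': "q = Suc q'" using pq(1) by (cases q) auto
      show ?thesis
      proof (cases p)
        case 0
        then show ?thesis using en(4)[of q'] pq zero q' by auto
      next
        case (Suc p')
        then have "p' < q' \<and> Suc q' < length ls \<and> enhanced_step ls p' = (I p, J p, A p) \<and>
            enhanced_step ls q' = (I q, J q, A q) \<and> I q < J p"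
          using pq q' r[of q'] e by simp
        then show ?thesis using coh unfolding coherent_lattice_path_def by blast
      qed
    qed
  qed
  \<comment> \<open>the virtual index \<open>0\<close> needs a slope below that of \<open>1\<close>\<close>
  define c' where "c' = fun_upd c 0 (c 1 - 1)"
  have "strict_mono_on {0..n} c'"
  proof (rule strict_mono_onI)
    fix i j assume ij: "i \<in> {0..n}" "j \<in> {0..n}" "i < j"
    then show "c' i < c' j" using c_strict_less[of i j] c_le[of 1 j] by (auto simp: c'_def)
  qed
  then obtain \<omega> s where ex: "\<And>m. m \<le> r \<Longrightarrow> exchange_at {0..n} c' \<omega> (s m) (I m) (J m) (A m)"
    using realization by blast
  have h: "height c' \<omega> t l = height c \<omega> t l" if "l \<in> {1..n}" for t l
    using that by (simp add: height_def c'_def)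
  have "exchange_times \<omega> (\<lambda>q. s (Suc q)) ls"
    unfolding exchange_times_def
  proof (intro allI impI)
    fix q i j a assume q: "Suc q < length ls" "enhanced_step ls q = (i, j, a)"
    then have "exchange_at {0..n} c' \<omega> (s (Suc q)) i j a"
      using ex[of "Suc q"] e[of q] by (simp add: r_def)
    then show "exchange_at {1..n} c \<omega> (s (Suc q)) i j a"
      using enhanced_step_facts[OF q] unfolding exchange_at_def by (auto simp: h[symmetric])
  qed
  then show ?thesis by blast
qed

lemma coherent_iff: "coherent_monotone_path n c (map lattice_vertex ls) \<longleftrightarrow> coherent_lattice_path n ls"
  using exchange_times_coherent_lattice coherent_monotone_exchange_times
    exchange_times_coherent_monotone coherent_lattice_exchange_times by blast

end

end

theorem theorem4p8:
  fixes n :: nat and c :: "nat \<Rightarrow> real"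
  assumes "n \<ge> 3"
    and "strict_mono_on {1..n} c"
  shows "\<exists>f. bij_betw f {vs. coherent_monotone_path n c vs} {ls. coherent_lattice_path n ls}"
proof -
  have "bij_betw (map lattice_vertex) {ls. coherent_lattice_path n ls} {vs. coherent_monotone_path n c vs}"
    unfolding bij_betw_def
  proof
    show "inj_on (map lattice_vertex) {ls. coherent_lattice_path n ls}"
      by (rule inj_on_subset[OF inj_on_lattice_vertex[of n]]) (auto simp: coherent_lattice_path_def)
    show "map lattice_vertex ` {ls. coherent_lattice_path n ls} = {vs. coherent_monotone_path n c vs}"
    proof (intro equalityI subsetI)
      fix vs assume "vs \<in> map lattice_vertex ` {ls. coherent_lattice_path n ls}"
      then obtain ls where "vs = map lattice_vertex ls" "coherent_lattice_path n ls" by blast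
      then show "vs \<in> {vs. coherent_monotone_path n c vs}"
        using coherent_iff[OF assms, of ls] unfolding coherent_lattice_path_def by blast
    next
      fix vs assume "vs \<in> {vs. coherent_monotone_path n c vs}"
      then have vs: "coherent_monotone_path n c vs" by simp
      then have "monotone_path n c vs" by (simp add: coherent_monotone_path_def)
      then obtain ls where "diagonal_avoiding_path n ls" "map lattice_vertex ls = vs"
        using monotone_path_surj[OF assms] by blast
      then show "vs \<in> map lattice_vertex ` {ls. coherent_lattice_path n ls}"
        using coherent_iff[OF assms, of ls] vs by blast
    qed
  qed
  then show ?thesis using bij_betw_inv by blast
qed

end
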